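(* Let $\mathbb{S}=\mathbb{R}/2\pi\mathbb{Z}$ and for a positive integer $q$ and $t\in\mathbb{S}$ let $$U_q(t)=\bigl(\cos t,\ \sin t,\ \cos 3t,\ \sin 3t,\ \ldots,\ \cos(2q-1)t,\ \sin(2q-1)t\bigr)\in\mathbb{R}^{2q}.$$ Fix positive integers $k,m,n,r$ with $n$ even. Let $\Psi_{k,m}(t)=\bigl(U_{3k}(t),U_{3k}(5t),\ldots,U_{3k}(5^mt)\bigr)\in\mathbb{R}^{6k(m+1)}$, let $A_{m,n}=\{2\pi j/(n5^m):\ j=0,\ldots,n5^m-1\}\subset\mathbb{S}$, and let $P=\operatorname{conv}\bigl(\Psi_{k,m}(t):\ t\in A_{m,n}\bigr)\subset\mathbb{R}^{6k(m+1)}$ (a centrally symmetric polytope with $n5^m$ vertices). For $d=6kr(m+1)$, identify $\mathbb{R}^d$ with the direct sum of $r$ copies of $\mathbb{R}^{6k(m+1)}$, each containing a copy of $P$, and let $Q\subset\mathbb{R}^d$ be the convex hull of the union of these $r$ copies of $P$ (so $Q$ is a centrally symmetric polytope with $rn5^m$ vertices). If $$r<\min\left\{(k+1)!,\ \left(\frac{5^{k-1}}{5^{k-1}-1}\right)^m\right\},$$ then the probability that $r$ vertices of $Q$, chosen independently at random from the uniform distribution on the set of vertices of $Q$, span a face of $Q$ (i.e. their convex hull is a face of $Q$) is at least $$\left(1-\frac{r}{(k+1)!}\right)\left(1-r\left(1-5^{-k+1}\right)^m\right).$$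
   Context: A polytope is the convex hull of finitely many points in $\mathbb{R}^d$. A face of a convex body is its intersection with a supporting affine hyperplane. *)

theory Defs
  imports "HOL-Analysis.Analysis" "HOL-Library.Function_Algebras"
begin

text \<open>Real vector space structure on functions (used for nat \<Rightarrow> real, i.e. finitely
  supported coordinate vectors; R^d is identified with functions vanishing outside {0..<d}).\<close>

instantiation "fun" :: (type, real_vector) real_vector
begin
definition scaleR_fun :: "real \<Rightarrow> ('a \<Rightarrow> 'b) \<Rightarrow> 'a \<Rightarrow> 'b" where
  "scaleR_fun c f = (\<lambda>x. c *\<^sub>R f x)"
instance
  by standard (auto simp: scaleR_fun_def fun_eq_iff scaleR_add_right scaleR_add_left)
end

definition U :: "nat \<Rightarrow> real \<Rightarrow> nat \<Rightarrow> real" where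
  "U q t c = (if c < 2 * q then
                (if even c then cos (real (2 * (c div 2) + 1) * t)
                 else sin (real (2 * (c div 2) + 1) * t))
              else 0)"

definition Psi :: "nat \<Rightarrow> nat \<Rightarrow> real \<Rightarrow> nat \<Rightarrow> real" where
  "Psi k m t c = (if c < 6 * k * (m + 1) then
                    U (3 * k) (5 ^ (c div (6 * k)) * t) (c mod (6 * k))
                  else 0)"

definition Aset :: "nat \<Rightarrow> nat \<Rightarrow> real set" where
  "Aset m n = {2 * pi * real j / real (n * 5 ^ m) | j. j < n * 5 ^ m}"

definition Ppoly :: "nat \<Rightarrow> nat \<Rightarrow> nat \<Rightarrow> (nat \<Rightarrow> real) set" where
  "Ppoly k m n = convex hull (Psi k m ` Aset m n)"

definition embed :: "nat \<Rightarrow> nat \<Rightarrow> (nat \<Rightarrow> real) \<Rightarrow> nat \<Rightarrow> real" where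
  "embed D l x = (\<lambda>c. if l * D \<le> c \<and> c < (l + 1) * D then x (c - l * D) else 0)"

definition Qpoly :: "nat \<Rightarrow> nat \<Rightarrow> nat \<Rightarrow> nat \<Rightarrow> (nat \<Rightarrow> real) set" where
  "Qpoly k m n r = convex hull (\<Union>l<r. embed (6 * k * (m + 1)) l ` Ppoly k m n)"

definition is_face :: "nat \<Rightarrow> (nat \<Rightarrow> real) set \<Rightarrow> (nat \<Rightarrow> real) set \<Rightarrow> bool" where
  "is_face d F S \<longleftrightarrow> (\<exists>a b. (\<exists>i<d. a i \<noteq> 0) \<and> (\<forall>x\<in>S. (\<Sum>i<d. a i * x i) \<le> b)
       \<and> F \<noteq> {} \<and> F = {x\<in>S. (\<Sum>i<d. a i * x i) = b})"

definition vertices :: "(nat \<Rightarrow> real) set \<Rightarrow> (nat \<Rightarrow> real) set" where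
  "vertices S = {v. v extreme_point_of S}"

definition face_prob :: "nat \<Rightarrow> nat \<Rightarrow> (nat \<Rightarrow> real) set \<Rightarrow> real" where
  "face_prob d r S =
     real (card {f \<in> PiE {..<r} (\<lambda>_. vertices S). is_face d (convex hull (f ` {..<r})) S})
     / real (card (PiE {..<r} (\<lambda>_. vertices S)))"

end

theory Submission
  imports Defs
begin

text \<open>
  A functional on \<open>\<real>\<^sup>d\<close> restricts, along the curve in each of the \<open>r\<close> summands, to a sum of
  odd-frequency trigonometric polynomials in \<open>t, 5t, \<dots>, 5\<^sup>m t\<close>, so faces are exhibited by such sums
  that are at most \<open>1\<close> with equality exactly at the prescribed points.

  Suppose at most \<open>k\<close> points \<open>5\<^sup>i t\<close> lie in an arc of length \<open>2\<pi>/5\<close> with centre \<open>\<theta>\<close>. Interpolating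
  \<open>z\<^sup>-\<^sup>1\<^sup>/\<^sup>2\<close> by a polynomial \<open>p\<close> at the values \<open>z = cos\<^sup>2(5\<^sup>i t - \<theta>) > 1/2\<close>, the function
  \<open>f(x) = cos(x - \<theta>) p(cos\<^sup>2(x - \<theta>))\<close> has degree at most \<open>2k - 1\<close>, equals \<open>1\<close> at the given points and satisfies
  \<open>|f| < 2\<close>; hence \<open>(3f - f\<^sup>3)/2 \<le> 1\<close> with equality only where \<open>f = 1\<close>, and subtracting a small
  multiple of \<open>f \<Prod> sin\<^sup>2\<close> removes the superfluous contact points. Each of the levels
  \<open>i - 1, \<dots>, 0\<close> contributes a further small perturbation which selects the right ones among
  the at most \<open>5k\<close> fifth roots; it exists since \<open>5k < 6k\<close> and no two of these roots are antipodal.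

  The arc condition at level \<open>i\<close> says that certain base 5 digits of the indices agree. The digits of
  a random index are independent, so \<open>g \<le> k\<close> indices agree in none of the \<open>m\<close> digits with
  probability \<open>(1 - 5\<^sup>1\<^sup>-\<^sup>g)\<^sup>m\<close>, while some copy of \<open>P\<close> receives more than \<open>k\<close> of the
  \<open>r\<close> points with probability at most \<open>r / (k + 1)!\<close>.
\<close>

section \<open>Trigonometric polynomials of fixed parity\<close>

text \<open>Frequencies share the parity of \<open>d\<close>. For odd \<open>d\<close> only odd
  frequencies occur, which are the ones \<open>U\<close> has coordinates for, and the function
  changes sign at the antipode (\<open>trig_antipode\<close>).\<close>

inductive trig_poly :: "nat \<Rightarrow> (real \<Rightarrow> real) \<Rightarrow> bool" for d where
  trig_monom: "h \<le> d \<Longrightarrow> even (d + h) \<Longrightarrow> trig_poly d (\<lambda>t. a * cos (real h * t) + b * sin (real h * t))"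
| trig_add: "trig_poly d f \<Longrightarrow> trig_poly d g \<Longrightarrow> trig_poly d (\<lambda>t. f t + g t)"

lemma trig_mono: "trig_poly d f \<Longrightarrow> d \<le> e \<Longrightarrow> even (d + e) \<Longrightarrow> trig_poly e f"
proof (induction rule: trig_poly.induct)
  case (trig_monom h a b)
  then show ?case by (intro trig_poly.trig_monom) auto
qed (auto intro: trig_add)

lemma trig_const: "even d \<Longrightarrow> trig_poly d (\<lambda>_. a)"
  using trig_monom[of 0 d a 0] by simp

lemma trig_0: "trig_poly d (\<lambda>_. 0)"
  using trig_monom[of d d 0 0] by simp

lemma trig_cmult: "trig_poly d f \<Longrightarrow> trig_poly d (\<lambda>t. c * f t)"
proof (induction rule: trig_poly.induct)
  case (trig_monom h a b)
  then show ?case using trig_poly.trig_monom[of h d "c * a" "c * b"] by (simp add: algebra_simps)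
next
  case (trig_add f g)
  then show ?case using trig_poly.trig_add[of d "\<lambda>t. c * f t" "\<lambda>t. c * g t"] by (simp add: algebra_simps)
qed

lemma trig_diff: "trig_poly d f \<Longrightarrow> trig_poly d g \<Longrightarrow> trig_poly d (\<lambda>t. f t - g t)"
  using trig_add[OF _ trig_cmult[of d g "-1"], of f] by simp

lemma trig_sum: "(\<And>x. x \<in> S \<Longrightarrow> trig_poly d (f x)) \<Longrightarrow> trig_poly d (\<lambda>t. \<Sum>x\<in>S. f x t)"
  by (induction S rule: infinite_finite_induct) (auto intro: trig_0 trig_add)

text \<open>Product-to-sum formulas: the frequencies \<open>h + h'\<close> and \<open>h - h'\<close>
  both have the parity of \<open>d + e\<close>. The assumption \<open>h' \<le> h\<close> keeps the
  natural subtraction exact.\<close>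

lemma trig_monom_mult_le:
  assumes "h \<le> d" "even (d + h)" "h' \<le> e" "even (e + h')" "h' \<le> h"
  shows "trig_poly (d + e) (\<lambda>t. (a * cos (real h * t) + b * sin (real h * t))
                          * (a' * cos (real h' * t) + b' * sin (real h' * t)))"
proof -
  define p where "p = (\<lambda>t. ((a*a' - b*b')/2) * cos (real (h + h') * t) + ((a*b' + b*a')/2) * sin (real (h + h') * t))"
  define m where "m = (\<lambda>t. ((a*a' + b*b')/2) * cos (real (h - h') * t) + ((b*a' - a*b')/2) * sin (real (h - h') * t))"
  have "trig_poly (d + e) p" unfolding p_def using assms by (intro trig_monom) auto
  moreover have "trig_poly (d + e) m" unfolding m_def using assms by (intro trig_monom) auto
  ultimately have "trig_poly (d + e) (\<lambda>t. p t + m t)" by (rule trig_add)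
  also have "(\<lambda>t. p t + m t) = (\<lambda>t. (a * cos (real h * t) + b * sin (real h * t))
                          * (a' * cos (real h' * t) + b' * sin (real h' * t)))"
    using assms(5) unfolding p_def m_def
    by (simp add: fun_eq_iff of_nat_diff ring_distribs cos_add sin_add cos_diff sin_diff)
      (simp add: field_simps)
  finally show ?thesis .
qed

lemma trig_mult: "trig_poly d f \<Longrightarrow> trig_poly e g \<Longrightarrow> trig_poly (d + e) (\<lambda>t. f t * g t)"
proof (induction rule: trig_poly.induct)
  case (trig_monom h a b)
  from trig_monom(3) show ?case
  proof (induction rule: trig_poly.induct)
    case (trig_monom h' a' b')
    show ?case
    proof (cases "h' \<le> h")
      case True
      with trig_monom \<open>h \<le> d\<close> \<open>even (d + h)\<close> show ?thesis by (intro trig_monom_mult_le)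
    next
      case False
      with trig_monom \<open>h \<le> d\<close> \<open>even (d + h)\<close>
        trig_monom_mult_le[of h' e h d a' b' a b] show ?thesis
        by (simp add: mult.commute add.commute)
    qed
  next
    case (trig_add f g)
    from trig_poly.trig_add[OF trig_add.IH] show ?case by (simp add: distrib_left)
  qed
next
  case (trig_add f1 f2)
  from trig_poly.trig_add[OF trig_add.IH[OF trig_add.prems]]
  show ?case by (simp add: distrib_right)
qed

lemma trig_prod:
  "(\<And>x. x \<in> S \<Longrightarrow> trig_poly e (f x)) \<Longrightarrow> trig_poly (e * card S) (\<lambda>t. \<Prod>x\<in>S. f x t)"
proof (induction S rule: infinite_finite_induct)
  case (insert x S)
  then show ?case using trig_mult[of e "f x" "e * card S"] by simp
qed (auto intro: trig_const)

lemma trig_Re: "trig_poly 1 (\<lambda>t. Re (cis t * w))"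
  using trig_monom[of 1 1 "Re w" "- Im w"] by (simp add: mult.commute)

lemma trig_Im: "trig_poly 1 (\<lambda>t. Im (cis t * w))"
  using trig_monom[of 1 1 "Im w" "Re w"] by (simp add: mult.commute add.commute)

lemma trig_antipode: "trig_poly d f \<Longrightarrow> odd d \<Longrightarrow> cis t = - cis t' \<Longrightarrow> f t = - f t'"
proof (induction rule: trig_poly.induct)
  case (trig_monom h a b)
  have "odd h" using trig_monom by simp
  then have "cis (real h * t) = - cis (real h * t')"
    using trig_monom(4) by (metis Complex.DeMoivre power_minus_odd)
  then show ?case by (simp add: complex_eq_iff)
qed auto

section \<open>Interpolation of the inverse square root\<close>

text \<open>Newton's form of the interpolation polynomial at the given nodes: the recursive call
  interpolates the divided difference. For distinct nodes that quotient matters only at points other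
  than \<open>a\<close>.\<close>

fun newton :: "real list \<Rightarrow> (real \<Rightarrow> real) \<Rightarrow> real \<Rightarrow> real" where
  "newton [] \<phi> z = 0"
| "newton (a # as) \<phi> z = \<phi> a + (z - a) * newton as (\<lambda>x. (\<phi> x - \<phi> a) / (x - a)) z"

lemma newton_interpolates: "distinct as \<Longrightarrow> x \<in> set as \<Longrightarrow> newton as \<phi> x = \<phi> x"
  by (induction as arbitrary: \<phi>) auto

lemma newton_cong: "(\<And>x. x \<in> set as \<Longrightarrow> \<phi> x = \<psi> x) \<Longrightarrow> newton as \<phi> z = newton as \<psi> z"
proof (induction as arbitrary: \<phi> \<psi>)
  case (Cons a as)
  have "newton as (\<lambda>x. (\<phi> x - \<phi> a) / (x - a)) z = newton as (\<lambda>x. (\<psi> x - \<psi> a) / (x - a)) z"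
    by (rule Cons.IH) (simp add: Cons.prems)
  then show ?case by (simp add: Cons.prems)
qed simp

lemma newton_cmult: "newton as (\<lambda>x. c * \<phi> x) z = c * newton as \<phi> z"
proof (induction as arbitrary: \<phi>)
  case (Cons a as)
  have *: "(\<lambda>x. (c * \<phi> x - c * \<phi> a) / (x - a)) = (\<lambda>x. c * ((\<phi> x - \<phi> a) / (x - a)))"
    by (auto simp: field_simps)
  have "newton (a # as) (\<lambda>x. c * \<phi> x) z
      = c * \<phi> a + (z - a) * (c * newton as (\<lambda>x. (\<phi> x - \<phi> a) / (x - a)) z)"
    unfolding newton.simps * by (subst Cons.IH) (rule refl)
  then show ?case by (simp add: distrib_left mult.left_commute)
qed simp

text \<open>The divided difference of \<open>inverse (\<alpha> * x + \<beta>)\<close> at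
  \<open>a\<close> is a constant multiple \<kappa> of the same function, so each node contributes
  exactly one factor to the relative error.\<close>

lemma newton_error_inverse_linear:
  assumes "\<And>a. a \<in> set as \<Longrightarrow> \<alpha> * a + \<beta> \<noteq> 0" "\<alpha> * z + \<beta> \<noteq> 0" "distinct as"
  shows "inverse (\<alpha> * z + \<beta>) - newton as (\<lambda>x. inverse (\<alpha> * x + \<beta>)) z
       = inverse (\<alpha> * z + \<beta>) * (\<Prod>a\<leftarrow>as. \<alpha> * (a - z) / (\<alpha> * a + \<beta>))"
  using assms
proof (induction as)
  case (Cons a as)
  define \<kappa> where "\<kappa> = - \<alpha> / (\<alpha> * a + \<beta>)"
  define N where "N = newton as (\<lambda>x. inverse (\<alpha> * x + \<beta>)) z"
  have "newton as (\<lambda>x. (inverse (\<alpha> * x + \<beta>) - inverse (\<alpha> * a + \<beta>)) / (x - a)) z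
      = newton as (\<lambda>x. \<kappa> * inverse (\<alpha> * x + \<beta>)) z"
  proof (rule newton_cong)
    fix x assume x: "x \<in> set as"
    then have "x \<noteq> a" "\<alpha> * x + \<beta> \<noteq> 0" "\<alpha> * a + \<beta> \<noteq> 0" using Cons.prems by auto
    then show "(inverse (\<alpha> * x + \<beta>) - inverse (\<alpha> * a + \<beta>)) / (x - a) = \<kappa> * inverse (\<alpha> * x + \<beta>)"
      unfolding \<kappa>_def by (simp add: divide_simps) (simp add: algebra_simps)
  qed
  then have "newton (a # as) (\<lambda>x. inverse (\<alpha> * x + \<beta>)) z
     = inverse (\<alpha> * a + \<beta>) + (z - a) * (\<kappa> * N)"
    by (simp add: newton_cmult N_def)
  then have "inverse (\<alpha> * z + \<beta>) - newton (a # as) (\<lambda>x. inverse (\<alpha> * x + \<beta>)) z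
     = (inverse (\<alpha> * z + \<beta>) - inverse (\<alpha> * a + \<beta>)) - (z - a) * (\<kappa> * N)" by simp
  also have "inverse (\<alpha> * z + \<beta>) - inverse (\<alpha> * a + \<beta>) = (z - a) * (\<kappa> * inverse (\<alpha> * z + \<beta>))"
    using Cons.prems(1)[of a] Cons.prems(2) unfolding \<kappa>_def by (simp add: divide_simps) (simp add: algebra_simps)
  also have "(z - a) * (\<kappa> * inverse (\<alpha> * z + \<beta>)) - (z - a) * (\<kappa> * N)
     = \<kappa> * (z - a) * (inverse (\<alpha> * z + \<beta>) - N)" by (simp add: algebra_simps)
  also have "inverse (\<alpha> * z + \<beta>) - N = inverse (\<alpha> * z + \<beta>) * (\<Prod>a\<leftarrow>as. \<alpha> * (a - z) / (\<alpha> * a + \<beta>))"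
    unfolding N_def using Cons.prems by (intro Cons.IH) auto
  also have "\<kappa> * (z - a) = \<alpha> * (a - z) / (\<alpha> * a + \<beta>)" by (simp add: \<kappa>_def right_diff_distrib diff_divide_distrib)
  finally show ?case by (simp only: list.map prod_list.Cons mult.left_commute)
qed simp

text \<open>Interpolation is linear in the interpolated function, so it commutes with integration
  over a parameter \<theta>.\<close>

lemma newton_has_integral:
  fixes \<Phi> :: "real \<Rightarrow> real \<Rightarrow> real"
  assumes "\<And>x. x \<in> set as \<Longrightarrow> ((\<lambda>\<theta>. \<Phi> \<theta> x) has_integral \<phi> x) J"
  shows "((\<lambda>\<theta>. newton as (\<Phi> \<theta>) z) has_integral newton as \<phi> z) J"
  using assms
proof (induction as arbitrary: \<Phi> \<phi>)
  case (Cons a as)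
  have "((\<lambda>\<theta>. newton as (\<lambda>x. (\<Phi> \<theta> x - \<Phi> \<theta> a) / (x - a)) z) has_integral
     newton as (\<lambda>x. (\<phi> x - \<phi> a) / (x - a)) z) J"
    by (rule Cons.IH) (intro has_integral_divide has_integral_diff Cons.prems; simp)
  then show ?case
    unfolding newton.simps by (intro has_integral_add has_integral_mult_right Cons.prems) simp_all
qed simp

section \<open>The inverse square root as an integral of such reciprocals\<close>

text \<open>Up to the factor \<open>pi / 2\<close>, this makes \<open>1 / sqrt z\<close> an average
  of reciprocals of linear functions of \<open>z\<close> with nonnegative coefficients, whose
  interpolation error is known exactly.\<close>

lemma has_integral_inverse_sqrt:
  fixes z :: real
  assumes "z > 0"
  shows "((\<lambda>\<theta>. inverse ((cos \<theta>)\<^sup>2 * z + (sin \<theta>)\<^sup>2)) has_integral (pi / 2) / sqrt z) {0..pi/2}"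
proof -
  define a where "a = sqrt z"
  have a: "a > 0" "z = a\<^sup>2" using assms by (auto simp: a_def)
  \<comment> \<open>The denominator that the subtraction formula for the tangent gives for
    \<open>arctan (tan \<theta> / a) - \<theta>\<close>.\<close>
  define D where "D = (\<lambda>\<theta>::real. a * (cos \<theta>)\<^sup>2 + (sin \<theta>)\<^sup>2)"
  \<comment> \<open>\<open>F\<close> is \<open>arctan (tan \<theta> / a) / a\<close>, written without a singularity at \<open>\<pi>/2\<close>.\<close>
  define F where "F = (\<lambda>\<theta>::real. (\<theta> + arctan ((1 - a) * (sin \<theta> * cos \<theta>) / D \<theta>)) / a)"
  have D: "D \<theta> > 0" for \<theta>
  proof (cases "cos \<theta> = 0")
    case True
    then show ?thesis using sin_cos_squared_add[of \<theta>] by (simp add: D_def)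
  next
    case False
    then show ?thesis using a by (simp add: D_def add_pos_nonneg)
  qed
  have E: "a\<^sup>2 * (cos \<theta>)\<^sup>2 + (sin \<theta>)\<^sup>2 > 0" for \<theta> :: real
  proof (cases "cos \<theta> = 0")
    case True
    then show ?thesis using sin_cos_squared_add[of \<theta>] by simp
  next
    case False
    then show ?thesis using a by (simp add: add_pos_nonneg)
  qed
  have der: "(F has_real_derivative inverse ((cos \<theta>)\<^sup>2 * z + (sin \<theta>)\<^sup>2)) (at \<theta>)" for \<theta>
  proof -
    let ?s = "sin \<theta>" and ?c = "cos \<theta>"
    define X where "X = (1 - a) * (?s * ?c)"
    define X' where "X' = (1 - a) * (?c\<^sup>2 - ?s\<^sup>2)"
    define D' where "D' = 2 * (1 - a) * (?s * ?c)"
    have d1: "((\<lambda>\<theta>. (1 - a) * (sin \<theta> * cos \<theta>)) has_real_derivative X') (at \<theta>)"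
      unfolding X'_def by (auto intro!: derivative_eq_intros simp: power2_eq_square algebra_simps)
    have d2: "(D has_real_derivative D') (at \<theta>)"
      unfolding D_def D'_def by (auto intro!: derivative_eq_intros simp: power2_eq_square algebra_simps)
    have dF: "(F has_real_derivative
        (1 + inverse (1 + (X / D \<theta>)\<^sup>2) * ((X' * D \<theta> - X * D') / (D \<theta> * D \<theta>))) / a) (at \<theta>)"
    proof -
      have "((\<lambda>\<theta>. (1 - a) * (sin \<theta> * cos \<theta>) / D \<theta>) has_real_derivative
          (X' * D \<theta> - X * D') / (D \<theta> * D \<theta>)) (at \<theta>)"
        unfolding X_def by (rule DERIV_divide[OF d1 d2]) (use D[of \<theta>] in simp)
      from DERIV_cdivide[OF DERIV_add[OF DERIV_ident DERIV_chain2[OF DERIV_arctan this]], of a]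
      show ?thesis unfolding F_def X_def .
    qed
    have one: "?s\<^sup>2 + ?c\<^sup>2 = 1" by simp
    have K: "(D \<theta>)\<^sup>2 + X\<^sup>2 = a\<^sup>2 * ?c\<^sup>2 + ?s\<^sup>2"
    proof -
      \<comment> \<open>The factor \<open>s\<^sup>2 + c\<^sup>2\<close>, which equals 1 here, makes
        both sides homogeneous of the same degree, so the identity holds for arbitrary
        \<open>s\<close> and \<open>c\<close> by expansion.\<close>
      have "(a * c\<^sup>2 + s\<^sup>2)\<^sup>2 + ((1 - a) * (s * c))\<^sup>2 = (a\<^sup>2 * c\<^sup>2 + s\<^sup>2) * (s\<^sup>2 + c\<^sup>2)" for s c
        by (simp add: power2_eq_square algebra_simps)
      then show ?thesis unfolding D_def X_def one by simp
    qed
    have L: "X' * D \<theta> - X * D' = a - (a\<^sup>2 * ?c\<^sup>2 + ?s\<^sup>2)"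
    proof -
      have "(1 - a) * (c\<^sup>2 - s\<^sup>2) * (a * c\<^sup>2 + s\<^sup>2) - (1 - a) * (s * c) * (2 * (1 - a) * (s * c))
          = a * (s\<^sup>2 + c\<^sup>2)\<^sup>2 - (a\<^sup>2 * c\<^sup>2 + s\<^sup>2) * (s\<^sup>2 + c\<^sup>2)" for s c
        by (simp add: power2_eq_square algebra_simps)
      then show ?thesis unfolding D_def X_def D'_def X'_def one by simp
    qed
    have "1 + (X / D \<theta>)\<^sup>2 = ((D \<theta>)\<^sup>2 + X\<^sup>2) / (D \<theta> * D \<theta>)"
      using D[of \<theta>] by (simp add: field_simps power2_eq_square)
    then have "inverse (1 + (X / D \<theta>)\<^sup>2) * ((X' * D \<theta> - X * D') / (D \<theta> * D \<theta>))
       = (a - (a\<^sup>2 * ?c\<^sup>2 + ?s\<^sup>2)) / (a\<^sup>2 * ?c\<^sup>2 + ?s\<^sup>2)"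
      unfolding K L using D[of \<theta>] by simp
    moreover have "(1 + (a - e) / e) / a = inverse e" if "e > 0" for e
      using that a by (simp add: field_simps)
    ultimately have "(1 + inverse (1 + (X / D \<theta>)\<^sup>2) * ((X' * D \<theta> - X * D') / (D \<theta> * D \<theta>))) / a
       = inverse (?c\<^sup>2 * z + ?s\<^sup>2)"
      using E[of \<theta>] unfolding a(2) by (simp add: mult.commute)
    with dF show ?thesis by simp
  qed
  have "((\<lambda>\<theta>. inverse ((cos \<theta>)\<^sup>2 * z + (sin \<theta>)\<^sup>2)) has_integral F (pi/2) - F 0) {0..pi/2}"
    by (rule fundamental_theorem_of_calculus)
      (auto intro: has_field_derivative_at_within der simp: has_real_derivative_iff_has_vector_derivative[symmetric])
  then show ?thesis by (simp add: F_def a_def)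
qed

lemma abs_prod_list_le:
  fixes f g :: "'a \<Rightarrow> real"
  shows "(\<And>a. a \<in> set as \<Longrightarrow> \<bar>f a\<bar> \<le> g a) \<Longrightarrow> \<bar>\<Prod>a\<leftarrow>as. f a\<bar> \<le> (\<Prod>a\<leftarrow>as. g a)"
  by (induction as) (auto simp: abs_mult intro!: mult_mono, smt (verit))

lemma prod_list_lt_1:
  fixes f :: "'a \<Rightarrow> real"
  assumes "as \<noteq> []" "\<And>a. a \<in> set as \<Longrightarrow> 0 \<le> f a \<and> f a < 1"
  shows "0 \<le> (\<Prod>a\<leftarrow>as. f a) \<and> (\<Prod>a\<leftarrow>as. f a) < 1"
  using assms
proof (induction as)
  case (Cons a as)
  show ?case
  proof (cases "as = []")
    case True
    then show ?thesis using Cons by simp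
  next
    case False
    then have "0 \<le> (\<Prod>a\<leftarrow>as. f a) \<and> (\<Prod>a\<leftarrow>as. f a) < 1" "0 \<le> f a" "f a < 1" using Cons by auto
    then show ?thesis using mult_strict_mono'[of "f a" 1 "\<Prod>a\<leftarrow>as. f a" 1] by simp
  qed
qed simp

text \<open>The relative error of interpolating each reciprocal under the integral is at most the
  same \<delta> < 1. Integrating over \<theta> carries this bound over to
  \<open>1 / sqrt z\<close>.\<close>

lemma newton_inverse_sqrt_error:
  assumes "distinct as" "as \<noteq> []" "0 < z" "z \<le> 1" "\<And>a. a \<in> set as \<Longrightarrow> 1/2 < a"
  shows "\<bar>1 - sqrt z * newton as (\<lambda>x. 1 / sqrt x) z\<bar> < 1"
proof -
  define \<phi> where "\<phi> = (\<lambda>x::real. (pi / 2) / sqrt x)"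
  define \<Phi> where "\<Phi> = (\<lambda>\<theta> x::real. inverse ((cos \<theta>)\<^sup>2 * x + (sin \<theta>)\<^sup>2))"
  define \<delta> where "\<delta> = (\<Prod>a\<leftarrow>as. \<bar>a - z\<bar> / a)"
  have \<delta>: "\<delta> < 1"
    unfolding \<delta>_def
  proof (intro conjunct2[OF prod_list_lt_1] assms(2))
    fix a assume "a \<in> set as"
    \<comment> \<open>This is what the threshold 1/2 is for: \<open>z \<le> 1 < 2 * a\<close> gives
      \<open>z - a < a\<close>.\<close>
    then show "0 \<le> \<bar>a - z\<bar> / a \<and> \<bar>a - z\<bar> / a < 1" using assms(3,4) assms(5)[of a] by (auto simp: field_simps)
  qed
  have pos: "(cos \<theta>)\<^sup>2 * x + (sin \<theta>)\<^sup>2 > 0" if "x > 0" for \<theta> x :: real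
    using that sin_cos_squared_add[of \<theta>]
    by (cases "cos \<theta> = 0") (auto intro: add_pos_nonneg)
  have i1: "((\<lambda>\<theta>. \<Phi> \<theta> x) has_integral \<phi> x) {0..pi/2}" if "x > 0" for x
    unfolding \<Phi>_def \<phi>_def using that by (rule has_integral_inverse_sqrt)
  have i2: "((\<lambda>\<theta>. newton as (\<Phi> \<theta>) z) has_integral newton as \<phi> z) {0..pi/2}"
    by (intro newton_has_integral i1) (use assms(5) in fastforce)
  have i3: "((\<lambda>\<theta>. \<Phi> \<theta> z - newton as (\<Phi> \<theta>) z) has_integral (\<phi> z - newton as \<phi> z)) {0..pi/2}"
    by (intro has_integral_diff i1 i2 assms)
  have i4: "((\<lambda>\<theta>. \<delta> * \<Phi> \<theta> z) has_integral \<delta> * \<phi> z) {0..pi/2}"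
    by (intro has_integral_mult_right i1 assms)
  have bound: "\<bar>\<Phi> \<theta> z - newton as (\<Phi> \<theta>) z\<bar> \<le> \<delta> * \<Phi> \<theta> z" for \<theta>
  proof -
    let ?\<alpha> = "(cos \<theta>)\<^sup>2" and ?\<beta> = "(sin \<theta>)\<^sup>2"
    have nz: "?\<alpha> * a + ?\<beta> > 0" if "a \<in> set as" for a using pos[of a \<theta>] assms(5)[OF that] by simp
    have "\<Phi> \<theta> z - newton as (\<Phi> \<theta>) z = \<Phi> \<theta> z * (\<Prod>a\<leftarrow>as. ?\<alpha> * (a - z) / (?\<alpha> * a + ?\<beta>))"
      unfolding \<Phi>_def
      by (rule newton_error_inverse_linear) (use nz pos[OF assms(3), of \<theta>] assms(1) in force)+
    moreover have "\<bar>\<Prod>a\<leftarrow>as. ?\<alpha> * (a - z) / (?\<alpha> * a + ?\<beta>)\<bar> \<le> \<delta>"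
      unfolding \<delta>_def
    proof (rule abs_prod_list_le)
      fix a assume a: "a \<in> set as"
      then have "a > 0" using assms(5)[of a] by simp
      \<comment> \<open>Dropping the nonnegative \<open>?\<beta>\<close> from the denominator gives
        a bound on the factor that is independent of \<theta>.\<close>
      moreover have "?\<alpha> * \<bar>a - z\<bar> * a \<le> \<bar>a - z\<bar> * (?\<alpha> * a + ?\<beta>)" by (simp add: algebra_simps)
      ultimately show "\<bar>?\<alpha> * (a - z) / (?\<alpha> * a + ?\<beta>)\<bar> \<le> \<bar>a - z\<bar> / a"
        using nz[OF a] by (simp add: abs_mult divide_simps)
    qed
    moreover have "\<Phi> \<theta> z > 0" unfolding \<Phi>_def using pos assms(3) by simp
    ultimately show ?thesis by (simp add: abs_mult mult.commute)
  qed
  have "\<phi> z - newton as \<phi> z \<le> \<delta> * \<phi> z"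
    by (rule has_integral_le[OF i3 i4]) (use bound abs_le_D1 in blast)
  moreover have "- (\<phi> z - newton as \<phi> z) \<le> \<delta> * \<phi> z"
    by (rule has_integral_le[OF has_integral_neg[OF i3] i4]) (use bound abs_le_D2 in blast)
  ultimately have "\<bar>\<phi> z - newton as \<phi> z\<bar> \<le> \<delta> * \<phi> z" by linarith
  moreover have "newton as \<phi> z = (pi / 2) * newton as (\<lambda>x. 1 / sqrt x) z"
    unfolding \<phi>_def newton_cmult[symmetric] by simp
  moreover have "\<phi> z = (pi / 2) * (1 / sqrt z)" by (simp add: \<phi>_def)
  ultimately have "\<bar>(pi / 2) * (1 / sqrt z - newton as (\<lambda>x. 1 / sqrt x) z)\<bar> \<le> (pi / 2) * (\<delta> * (1 / sqrt z))"
    by (simp add: algebra_simps)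
  moreover have "\<bar>(pi / 2) * x\<bar> = (pi / 2) * \<bar>x\<bar>" for x
    by (simp add: abs_mult)
  ultimately have *: "\<bar>1 / sqrt z - newton as (\<lambda>x. 1 / sqrt x) z\<bar> \<le> \<delta> * (1 / sqrt z)"
    using mult_le_cancel_left_pos[of "pi / 2"] pi_gt_zero by (metis half_gt_zero)
  have "\<bar>1 - sqrt z * newton as (\<lambda>x. 1 / sqrt x) z\<bar>
       = \<bar>sqrt z * (1 / sqrt z - newton as (\<lambda>x. 1 / sqrt x) z)\<bar>"
    using assms(3) by (simp add: algebra_simps)
  also have "\<dots> = sqrt z * \<bar>1 / sqrt z - newton as (\<lambda>x. 1 / sqrt x) z\<bar>" using assms(3) by (simp add: abs_mult)
  also have "\<dots> \<le> sqrt z * (\<delta> * (1 / sqrt z))" using * assms(3) by (intro mult_left_mono) auto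
  also have "\<dots> = \<delta>" using assms(3) by simp
  finally show ?thesis using \<delta> by simp
qed

text \<open>Interpolation at \<open>Suc (length as)\<close> nodes has degree at most
  \<open>length as\<close> in \<open>g\<close>; writing the list as \<open>a # as\<close> avoids a
  truncated subtraction.\<close>

lemma trig_newton:
  assumes "trig_poly 2 g"
  shows "trig_poly (2 * length as) (\<lambda>t. newton (a # as) \<phi> (g t))"
proof (induction as arbitrary: a \<phi>)
  case Nil
  then show ?case by (simp add: trig_const)
next
  case (Cons b as)
  have "trig_poly 2 (\<lambda>t. g t - a)" using trig_diff[OF assms trig_const[of 2]] by simp
  from trig_mult[OF this Cons.IH[of b "\<lambda>x. (\<phi> x - \<phi> a) / (x - a)"]]
  have "trig_poly (2 * length (b # as)) (\<lambda>t. (g t - a) * newton (b # as) (\<lambda>x. (\<phi> x - \<phi> a) / (x - a)) (g t))"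
    by simp
  from trig_add[OF trig_const[of _ "\<phi> a"] this]
  show ?case by simp
qed

section \<open>Trigonometric polynomials with prescribed peaks\<close>

lemma Im_cnj_eq_0:
  assumes "norm x = 1" "norm y = 1" "Im (x * cnj y) = 0"
  shows "x = y \<or> x = - y"
proof -
  have "norm (x * cnj y) = 1" using assms by (simp add: norm_mult)
  then have "(Re (x * cnj y))\<^sup>2 = 1" using assms(3) by (simp add: cmod_def)
  then have "Re (x * cnj y) = 1 \<or> Re (x * cnj y) = -1" by (simp add: power2_eq_1_iff)
  with assms(3) have "x * cnj y = 1 \<or> x * cnj y = -1" by (auto simp: complex_eq_iff)
  moreover have "cnj y * y = 1"
    using assms(2) complex_norm_square[of y] by (simp add: mult.commute)
  then have "x = (x * cnj y) * y" by (simp add: mult.assoc)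
  ultimately show ?thesis by (metis mult_1 mult_minus1)
qed

lemma Re_cnj_self: "norm y = 1 \<Longrightarrow> Re (y * cnj y) = 1"
  using complex_norm_square[of y] by (metis Re_complex_of_real of_real_power one_power2)

lemma ex_cis: "norm y = 1 \<Longrightarrow> \<exists>t. y = cis t"
  by (metis cis_Arg norm_eq_zero sgn_eq zero_neq_one div_by_1 of_real_1)

text \<open>At a contact point every positive \<epsilon> works because \<open>v t \<le> 0\<close>;
  at any other point there is slack, which a small \<epsilon> cannot use up. Finiteness of
  \<open>B\<close> gives one \<epsilon> for all points.\<close>

lemma small_perturbation:
  fixes F v :: "'a \<Rightarrow> real"
  assumes "finite B" "\<And>t. t \<in> B \<Longrightarrow> F t \<le> 1" "\<And>t. t \<in> B \<Longrightarrow> F t = 1 \<Longrightarrow> v t \<le> 0"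
  shows "\<exists>\<epsilon>. \<forall>t\<in>B. F t + \<epsilon> * v t \<le> 1 \<and> (F t + \<epsilon> * v t = 1 \<longleftrightarrow> F t = 1 \<and> v t = 0)"
proof -
  have "\<forall>\<^sub>F \<epsilon> in at_right 0. F t + \<epsilon> * v t \<le> 1 \<and> (F t + \<epsilon> * v t = 1 \<longleftrightarrow> F t = 1 \<and> v t = 0)"
    if t: "t \<in> B" for t
  proof (cases "F t = 1")
    case True
    then have "v t \<le> 0" using assms(3) t by blast
    have "\<forall>\<^sub>F \<epsilon>::real in at_right 0. 0 < \<epsilon>" by (rule eventually_at_right_less)
    then show ?thesis
      by eventually_elim (use True \<open>v t \<le> 0\<close> in \<open>auto simp: mult_le_0_iff\<close>)
  next
    case False
    then have "F t < 1" using assms(2)[OF t] by simp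
    have "((\<lambda>\<epsilon>. F t + \<epsilon> * v t) \<longlongrightarrow> F t + 0 * v t) (at_right 0)"
      by (intro tendsto_intros)
    then have "\<forall>\<^sub>F \<epsilon> in at_right 0. F t + \<epsilon> * v t < 1"
      by (rule order_tendstoD(2)) (use \<open>F t < 1\<close> in simp)
    then show ?thesis by eventually_elim (use False in auto)
  qed
  then have "\<forall>\<^sub>F \<epsilon> in at_right 0. \<forall>t\<in>B. F t + \<epsilon> * v t \<le> 1 \<and> (F t + \<epsilon> * v t = 1 \<longleftrightarrow> F t = 1 \<and> v t = 0)"
    using assms(1) by (simp add: eventually_ball_finite)
  then show ?thesis
    by (rule eventually_happens'[rotated]) simp
qed

section \<open>Peaks at points of one short arc\<close>

lemma ex_trig_interpolating_1:
  assumes "finite Y" "Y \<noteq> {}" "norm w = 1"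
    and "\<And>y. y \<in> Y \<Longrightarrow> norm y = 1 \<and> sqrt (1/2) < Re (y * cnj w)"
  shows "\<exists>f. trig_poly (2 * card Y - 1) f \<and> (\<forall>t. cis t \<in> Y \<longrightarrow> f t = 1) \<and> (\<forall>t. \<bar>f t\<bar> < 2)"
proof -
  \<comment> \<open>Points of \<open>Y\<close> that are mirror images in the axis through
    \<open>w\<close> give the same node, hence only \<open>card Z \<le> card Y\<close>.\<close>
  define Z where "Z = (\<lambda>y. (Re (y * cnj w))\<^sup>2) ` Y"
  have Z: "finite Z" "Z \<noteq> {}" "card Z \<le> card Y" using assms(1,2) by (auto simp: Z_def card_image_le)
  obtain a as where as: "set (a # as) = Z" "distinct (a # as)"
    using finite_distinct_list[OF Z(1)] Z(2) by (metis list.exhaust set_empty)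
  have len: "Suc (length as) = card Z" using as distinct_card by fastforce
  have Zgt: "1/2 < z" if z: "z \<in> Z" for z
  proof -
    obtain y where y: "y \<in> Y" "z = (Re (y * cnj w))\<^sup>2" using z unfolding Z_def by blast
    have "(sqrt (1/2))\<^sup>2 < (Re (y * cnj w))\<^sup>2"
      using assms(4)[OF y(1)] by (intro power_strict_mono) auto
    then show ?thesis using y by simp
  qed
  define C where "C = (\<lambda>t. Re (cis t * cnj w))"
  define N where "N = newton (a # as) (\<lambda>x. 1 / sqrt x)"
  define f where "f = (\<lambda>t. C t * N ((C t)\<^sup>2))"
  have "trig_poly 1 C" unfolding C_def by (rule trig_Re)
  from trig_mult[OF this this] have "trig_poly 2 (\<lambda>t. (C t)\<^sup>2)"
    by (simp add: power2_eq_square numeral_2_eq_2)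
  from trig_mult[OF \<open>trig_poly 1 C\<close> trig_newton[OF this]]
  have "trig_poly (1 + 2 * length as) f" unfolding f_def N_def .
  then have "trig_poly (2 * card Y - 1) f" by (rule trig_mono) (use len Z in auto)
  moreover have "f t = 1" if t: "cis t \<in> Y" for t
  proof -
    have "(C t)\<^sup>2 \<in> Z" using t unfolding Z_def C_def by blast
    then have "N ((C t)\<^sup>2) = 1 / sqrt ((C t)\<^sup>2)"
      unfolding N_def using as by (intro newton_interpolates) auto
    moreover have "0 < C t"
      using assms(4)[OF t] unfolding C_def by (meson less_trans real_sqrt_gt_zero zero_less_divide_1_iff zero_less_numeral)
    ultimately show ?thesis by (simp add: f_def)
  qed
  moreover have "\<bar>f t\<bar> < 2" for t
  proof (cases "C t = 0")
    case True
    then show ?thesis by (simp add: f_def)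
  next
    case False
    have "\<bar>C t\<bar> \<le> norm (cis t * cnj w)" unfolding C_def by (rule abs_Re_le_cmod)
    then have "\<bar>C t\<bar> \<le> 1" using assms(3) by (simp add: norm_mult)
    then have "(C t)\<^sup>2 \<le> 1" by (simp add: abs_square_le_1)
    have "\<bar>1 - sqrt ((C t)\<^sup>2) * N ((C t)\<^sup>2)\<bar> < 1"
      unfolding N_def
      by (rule newton_inverse_sqrt_error) (use as Zgt False \<open>(C t)\<^sup>2 \<le> 1\<close> in auto)
    \<comment> \<open>An error below 1 around the value 1 confines
      \<open>\<bar>C t\<bar> * N ((C t)\<^sup>2)\<close> to the interval between 0 and 2.\<close>
    then have "\<bar>\<bar>C t\<bar> * N ((C t)\<^sup>2)\<bar> < 2" by (simp add: abs_less_iff)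
    then show ?thesis by (simp add: f_def abs_mult)
  qed
  ultimately show ?thesis by blast
qed

text \<open>With \<open>c = card Y\<close>, the cube of \<open>f\<close> has degree
  \<open>6 * c - 3\<close> and the correcting product has degree \<open>4 * c - 1\<close>; both are
  odd and at most \<open>6 * k - 1\<close>.\<close>

lemma ex_trig_peak:
  assumes "finite Y" "Y \<noteq> {}" "card Y \<le> k" "norm w = 1" "finite B"
    and "\<And>y. y \<in> Y \<Longrightarrow> norm y = 1 \<and> sqrt (1/2) < Re (y * cnj w)"
  shows "\<exists>F. trig_poly (6 * k - 1) F \<and> (\<forall>t\<in>B. F t \<le> 1 \<and> (F t = 1 \<longleftrightarrow> cis t \<in> Y))"
proof -
  define c where "c = card Y"
  have c: "0 < c" "c \<le> k" using assms by (auto simp: c_def card_gt_0_iff)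
  obtain f where f: "trig_poly (2 * c - 1) f" "\<And>t. cis t \<in> Y \<Longrightarrow> f t = 1" "\<And>t. \<bar>f t\<bar> < 2"
    unfolding c_def using ex_trig_interpolating_1[OF assms(1,2,4,6)] by blast
  \<comment> \<open>An odd cubic in \<open>f\<close>, so the parity is kept. It has a double contact
    with 1 at \<open>f = 1\<close>, and its other contact, at \<open>f = -2\<close>, is outside the
    range of \<open>f\<close>.\<close>
  define F where "F = (\<lambda>t. (3/2) * f t - (1/2) * (f t * (f t * f t)))"
  \<comment> \<open>Where \<open>f t = 1\<close> this is at most 0 and vanishes only at points of
    \<open>Y\<close> and their antipodes. At the antipodes the odd function \<open>f\<close> is -1,
    so they are no contact points.\<close>
  define v where "v = (\<lambda>t. (-1) * (f t * (\<Prod>y\<in>Y. Im (cis t * cnj y) * Im (cis t * cnj y))))"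
  have f': "trig_poly (6 * k - 1) f" by (rule trig_mono[OF f(1)]) (use c in auto)
  have "trig_poly (6 * k - 1) (\<lambda>t. f t * (f t * f t))"
    by (rule trig_mono[OF trig_mult[OF f(1) trig_mult[OF f(1) f(1)]]]) (use c in auto)
  then have F: "trig_poly (6 * k - 1) F" unfolding F_def by (intro trig_diff trig_cmult f')
  have "trig_poly ((1 + 1) * card Y) (\<lambda>t. \<Prod>y\<in>Y. Im (cis t * cnj y) * Im (cis t * cnj y))"
    by (intro trig_prod trig_mult trig_Im)
  from trig_mult[OF f(1) this] have "trig_poly (6 * k - 1) (\<lambda>t. f t * (\<Prod>y\<in>Y. Im (cis t * cnj y) * Im (cis t * cnj y)))"
    by (rule trig_mono) (use c in \<open>auto simp: c_def[symmetric]\<close>)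
  then have v: "trig_poly (6 * k - 1) v" unfolding v_def by (rule trig_cmult)
  have key: "1 - F t = (1 - f t)\<^sup>2 * (f t + 2) / 2" for t
    unfolding F_def by (simp add: power2_eq_square algebra_simps)
  have pos: "0 < f t + 2" for t using f(3)[of t] by linarith
  have F1: "F t \<le> 1" for t
  proof -
    have "0 \<le> 1 - F t" unfolding key using pos[of t] by simp
    then show ?thesis by simp
  qed
  have F2: "F t = 1 \<longleftrightarrow> f t = 1" for t
    using key[of t] pos[of t] by auto
  have sq: "0 \<le> (\<Prod>y\<in>Y. Im (cis t * cnj y) * Im (cis t * cnj y))" for t
    by (intro prod_nonneg) auto
  have *: "F t = 1 \<and> v t = 0 \<longleftrightarrow> cis t \<in> Y" for t
  proof
    assume a: "F t = 1 \<and> v t = 0"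
    then have "f t = 1" using F2 by blast
    then obtain y where y: "y \<in> Y" "Im (cis t * cnj y) = 0"
      using a assms(1) by (auto simp: v_def)
    then have "cis t = y \<or> cis t = - y" using assms(6) by (intro Im_cnj_eq_0) auto
    moreover have "cis t \<noteq> - y"
    proof
      assume "cis t = - y"
      moreover obtain s where "y = cis s" using ex_cis assms(6)[OF y(1)] by blast
      moreover have "odd (2 * c - 1)" using c by simp
      ultimately have "f t = - f s" using trig_antipode[OF f(1)] by blast
      then show False using f(2)[of s] \<open>y = cis s\<close> y(1) \<open>f t = 1\<close> by simp
    qed
    ultimately show "cis t \<in> Y" using y by auto
  next
    assume a: "cis t \<in> Y"
    have "(\<Prod>y\<in>Y. Im (cis t * cnj y) * Im (cis t * cnj y)) = 0"
      by (rule prod_zero[OF assms(1)]) (use a in \<open>auto intro!: bexI[of _ "cis t"]\<close>)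
    then show "F t = 1 \<and> v t = 0" using a f(2) F2 by (simp add: v_def)
  qed
  obtain \<epsilon> where \<epsilon>: "\<forall>t\<in>B. F t + \<epsilon> * v t \<le> 1 \<and> (F t + \<epsilon> * v t = 1 \<longleftrightarrow> F t = 1 \<and> v t = 0)"
    using small_perturbation[OF assms(5), of F v] F1 F2 sq by (auto simp: v_def)
  have "trig_poly (6 * k - 1) (\<lambda>t. F t + \<epsilon> * v t)" by (intro trig_add F trig_cmult v)
  then show ?thesis using \<epsilon> * by blast
qed

text \<open>Lagrange interpolation on the circle: \<open>p x\<close> is 1 at \<open>x\<close> and 0
  on the rest of \<open>X\<close>, and its denominators are nonzero because \<open>X\<close> has no
  antipodal pairs. The sum prescribes -1 on \<open>X - C\<close> and 0 on \<open>C\<close>.\<close>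

lemma ex_trig_separating:
  assumes "finite X" "C \<subseteq> X" "odd d" "card X \<le> d"
    and X: "\<And>x. x \<in> X \<Longrightarrow> norm x = 1 \<and> - x \<notin> X"
  shows "\<exists>v. trig_poly d v \<and> (\<forall>t. cis t \<in> C \<longrightarrow> v t = 0) \<and> (\<forall>t. cis t \<in> X - C \<longrightarrow> v t < 0)"
proof -
  define p where "p = (\<lambda>x t. \<Prod>y\<in>X - {x}. (1 / Im (x * cnj y)) * Im (cis t * cnj y))"
  \<comment> \<open>\<open>p x\<close> has degree \<open>card X - 1\<close>; when that is even, one
    more factor with value 1 at \<open>x\<close> makes the degree odd.\<close>
  define e where "e = (\<lambda>x t. if even (card X) then 1 else Re (cis t * cnj x))"
  define v where "v = (\<lambda>t. \<Sum>x\<in>X - C. (-1) * (p x t * e x t))"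
  have "trig_poly d (\<lambda>t. p x t * e x t)" if x: "x \<in> X" for x
  proof -
    have card: "card (X - {x}) = card X - 1" "card X > 0" using x assms(1) by (auto simp: card_gt_0_iff)
    have "trig_poly (1 * card (X - {x})) (p x)"
      unfolding p_def by (intro trig_prod trig_cmult trig_Im)
    then have p: "trig_poly (card X - 1) (p x)" using card by simp
    show ?thesis
    proof (cases "even (card X)")
      case True
      then have "trig_poly d (p x)" by (intro trig_mono[OF p]) (use assms(3,4) card in auto)
      then show ?thesis using True by (simp add: e_def)
    next
      case False
      have "trig_poly 1 (e x)" unfolding e_def using False trig_Re[of "cnj x"] by simp
      from trig_mult[OF p this] show ?thesis
        by (rule trig_mono) (use assms(3,4) card False in auto)
    qed
  qed
  then have "trig_poly d v" unfolding v_def by (intro trig_sum trig_cmult) auto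
  moreover have p0: "p x t = 0" if "cis t \<in> X" "x \<noteq> cis t" for x t
    unfolding p_def by (rule prod_zero) (use assms(1) that in \<open>auto intro!: bexI[of _ "cis t"]\<close>)
  moreover have "p (cis t) t * e (cis t) t = 1" if t: "cis t \<in> X" for t
  proof -
    have "Im (cis t * cnj y) \<noteq> 0" if "y \<in> X - {cis t}" for y
    proof
      assume "Im (cis t * cnj y) = 0"
      then have "cis t = y \<or> cis t = - y" using X that by (intro Im_cnj_eq_0) auto
      then show False using that X[of y] t by auto
    qed
    then have "p (cis t) t = 1" unfolding p_def by (intro prod.neutral) auto
    moreover have "e (cis t) t = 1" using Re_cnj_self[of "cis t"] by (simp add: e_def)
    ultimately show ?thesis by simp
  qed
  moreover have "v t = (\<Sum>x\<in>(X - C) \<inter> {cis t}. (-1) * (p x t * e x t))" if "cis t \<in> X" for t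
    unfolding v_def using assms(1) p0[OF that] by (intro sum.mono_neutral_right) auto
  ultimately have "v t = (if cis t \<in> C then 0 else -1)" if "cis t \<in> X" for t
    using that by (cases "cis t \<in> C") auto
  then show ?thesis using \<open>trig_poly d v\<close> assms(2)
    by (intro exI[of _ v]) (auto simp: subset_iff)
qed

section \<open>Descent through the powers of 5\<close>

lemma cis_mult_power: "cis (5 ^ (a + b) * t) = cis (5 ^ a * t) ^ 5 ^ b"
  by (simp add: Complex.DeMoivre power_add mult_ac)

text \<open>Downward induction on \<open>j\<close>. The levels above \<open>j\<close> determine the
  contact points up to a fifth root at level \<open>j\<close>; a small term in
  \<open>5 ^ j * t\<close> then keeps just the roots that come from \<open>T\<close>. At
  \<open>j = 0\<close> the contact set is \<open>T\<close> up to full turns.\<close>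

lemma ex_levels_peak:
  fixes T B :: "real set"
  assumes "finite B" "T \<subseteq> B" "T \<noteq> {}" "card T \<le> k" "norm w = 1"
    and arc: "\<And>t. t \<in> T \<Longrightarrow> sqrt (1/2) < Re (cis (5 ^ i * t) * cnj w)"
    and "j \<le> i"
  shows "\<exists>g. (\<forall>l. trig_poly (6 * k - 1) (g l)) \<and>
     (\<forall>t\<in>B. (\<Sum>l=j..i. g l (5 ^ l * t)) \<le> 1 \<and>
        ((\<Sum>l=j..i. g l (5 ^ l * t)) = 1 \<longleftrightarrow> cis (5 ^ j * t) \<in> (\<lambda>s. cis (5 ^ j * s)) ` T))"
  using assms(7)
proof (induction rule: inc_induct)
  case base
  have "finite T" using assms(1,2) finite_subset by blast
  have "\<exists>F. trig_poly (6 * k - 1) F \<and> (\<forall>t\<in>(\<lambda>t. 5 ^ i * t) ` B. F t \<le> 1 \<and> (F t = 1 \<longleftrightarrow> cis t \<in> (\<lambda>s. cis (5 ^ i * s)) ` T))"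
    using \<open>finite T\<close> assms arc
    by (intro ex_trig_peak[of _ _ w]) (auto intro: card_image_le order_trans)
  then obtain F where "trig_poly (6 * k - 1) F"
    "\<forall>t\<in>B. F (5 ^ i * t) \<le> 1 \<and> (F (5 ^ i * t) = 1 \<longleftrightarrow> cis (5 ^ i * t) \<in> (\<lambda>s. cis (5 ^ i * s)) ` T)" by auto
  then show ?case by (intro exI[of _ "\<lambda>_. F"]) simp
next
  case (step j)
  have fT: "finite T" using assms(1,2) finite_subset by blast
  have "k > 0" using fT assms(3,4) by (metis card_gt_0_iff gr_zeroI not_less)
  define S where "S = (\<lambda>g (t::real). \<Sum>l=Suc j..i. g l (5 ^ l * t) :: real)"
  obtain g where g: "\<And>l. trig_poly (6 * k - 1) (g l)"
     "\<And>t. t \<in> B \<Longrightarrow> S g t \<le> 1"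
     "\<And>t. t \<in> B \<Longrightarrow> S g t = 1 \<longleftrightarrow> cis (5 ^ Suc j * t) \<in> (\<lambda>s. cis (5 ^ Suc j * s)) ` T"
    using step.IH unfolding S_def by blast
  define C where "C = (\<lambda>s. cis (5 ^ j * s)) ` T"
  define X where "X = (\<Union>s\<in>T. {z::complex. z ^ 5 = cis (5 ^ Suc j * s)})"
  have pow: "cis (5 ^ Suc j * s) = cis (5 ^ j * s) ^ 5" for s
    using cis_mult_power[of j 1 s] by simp
  have X1: "finite X" unfolding X_def using fT by (auto intro!: finite_nth_roots)
  have "card X \<le> (\<Sum>s\<in>T. card {z::complex. z ^ 5 = cis (5 ^ Suc j * s)})"
    unfolding X_def by (rule card_UN_le[OF fT])
  also have "\<dots> = (\<Sum>s\<in>T. 5)" by (intro sum.cong refl card_nth_roots) auto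
  \<comment> \<open>At most \<open>5 * k\<close> roots, and \<open>5 * k \<le> 6 * k - 1\<close>
    since \<open>k\<close> is positive.\<close>
  also have "\<dots> \<le> 6 * k - 1" using assms(4) \<open>k > 0\<close> by simp
  finally have X2: "card X \<le> 6 * k - 1" .
  have X3: "norm x = 1 \<and> - x \<notin> X" if x: "x \<in> X" for x
  proof
    obtain s where s: "s \<in> T" "x ^ 5 = cis (5 ^ Suc j * s)" using x unfolding X_def by blast
    have "norm x ^ 5 = 1" using s(2) by (metis norm_power norm_cis)
    then show "norm x = 1" using power_eq_imp_eq_base[of "norm x" 5 1] by simp
    show "- x \<notin> X"
    proof
      assume "- x \<in> X"
      then obtain s' where s': "s' \<in> T" "(- x) ^ 5 = cis (5 ^ Suc j * s')" unfolding X_def by blast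
      obtain b where b: "i = Suc j + b" using step.hyps less_iff_Suc_add by (metis add_Suc less_eq_Suc_le le_Suc_ex)
      \<comment> \<open>Odd powers preserve antipodality, so antipodal roots would give antipodal
        points at level \<open>i\<close>, whereas all points there lie on the same side of the line
        orthogonal to \<open>w\<close>.\<close>
      have "cis (5 ^ i * s') = ((- x) ^ 5) ^ 5 ^ b" unfolding b s'(2) by (rule cis_mult_power)
      also have "\<dots> = - ((x ^ 5) ^ 5 ^ b)" by (simp add: power_minus_odd)
      also have "(x ^ 5) ^ 5 ^ b = cis (5 ^ i * s)" unfolding b s(2) by (rule cis_mult_power[symmetric])
      finally have "Re (cis (5 ^ i * s') * cnj w) = - Re (cis (5 ^ i * s) * cnj w)" by simp
      moreover have "0 \<le> sqrt (1/2 :: real)" by simp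
      ultimately show False using arc[OF s(1)] arc[OF s'(1)] by linarith
    qed
  qed
  have "C \<subseteq> X" unfolding C_def X_def using pow by auto
  then obtain v where v: "trig_poly (6 * k - 1) v" "\<And>t. cis t \<in> C \<Longrightarrow> v t = 0" "\<And>t. cis t \<in> X - C \<Longrightarrow> v t < 0"
    using ex_trig_separating[OF X1 _ _ X2 X3, of C] \<open>k > 0\<close> by auto
  have inX: "cis (5 ^ j * t) \<in> X \<longleftrightarrow> S g t = 1" if "t \<in> B" for t
    unfolding X_def g(3)[OF that] pow by blast
  obtain \<epsilon> where \<epsilon>: "\<And>t. t \<in> B \<Longrightarrow> S g t + \<epsilon> * v (5 ^ j * t) \<le> 1"
    "\<And>t. t \<in> B \<Longrightarrow> S g t + \<epsilon> * v (5 ^ j * t) = 1 \<longleftrightarrow> S g t = 1 \<and> v (5 ^ j * t) = 0"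
    using small_perturbation[OF assms(1), of "S g" "\<lambda>t. v (5 ^ j * t)"] g(2) v(2,3) inX
    by (metis DiffI order.refl order_less_imp_le)
  \<comment> \<open>The old family enters only through the levels from \<open>Suc j\<close> on, so
    its value at \<open>j\<close> may be overwritten.\<close>
  define g' where "g' = g(j := (\<lambda>x. \<epsilon> * v x))"
  have "trig_poly (6 * k - 1) (g' l)" for l using g(1) v(1) by (auto simp: g'_def intro: trig_cmult)
  moreover have "(\<Sum>l=j..i. g' l (5 ^ l * t)) = S g t + \<epsilon> * v (5 ^ j * t)" for t
  proof -
    have "(\<Sum>l=j..i. g' l (5 ^ l * t)) = g' j (5 ^ j * t) + (\<Sum>l=Suc j..i. g' l (5 ^ l * t))"
      using step.hyps by (intro sum.atLeast_Suc_atMost) simp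
    also have "(\<Sum>l=Suc j..i. g' l (5 ^ l * t)) = S g t"
      unfolding S_def g'_def by (intro sum.cong) auto
    finally show ?thesis by (simp add: g'_def)
  qed
  moreover have "S g t = 1 \<and> v (5 ^ j * t) = 0 \<longleftrightarrow> cis (5 ^ j * t) \<in> C" if "t \<in> B" for t
    using inX[OF that] v(2,3) \<open>C \<subseteq> X\<close> by (metis DiffI less_irrefl subsetD)
  ultimately show ?case using \<epsilon> unfolding C_def by (intro exI[of _ g']) auto
qed

section \<open>Functionals on the polytopes\<close>

text \<open>Digits of \<open>j div n\<close>, least significant first. Digit \<open>e\<close> tells
  in which fifth of the circle the angle of \<open>j\<close> lies after multiplication by
  \<open>5 ^ (m - 1 - e)\<close>.\<close>

definition digit :: "nat \<Rightarrow> nat \<Rightarrow> nat \<Rightarrow> nat" where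
  "digit n e j = j div n div 5 ^ e mod 5"

text \<open>Together with \<open>digit_top\<close> this splits an index below
  \<open>n * 5 ^ Suc m\<close> into a remainder carrying the lower \<open>m\<close> digits and a
  quotient that is the top digit; the counting by induction on \<open>m\<close> rests on it.\<close>

lemma digit_mod:
  assumes "e < m"
  shows "digit n e (j mod (n * 5 ^ m)) = digit n e j"
proof (cases "n = 0")
  case False
  have split: "x mod (a * b) div a = x div a mod b" if "a > 0" for x a b :: nat
    using that by (simp add: mod_mult2_eq)
  obtain q where q: "m = e + Suc q" using assms less_iff_Suc_add by auto
  have "j mod (n * 5 ^ m) div n div 5 ^ e = (j div n) mod (5 ^ e * 5 ^ Suc q) div 5 ^ e"
    using False unfolding q by (simp only: split power_add)
  also have "\<dots> = j div n div 5 ^ e mod 5 ^ Suc q" by (rule split) simp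
  also have "5 ^ Suc q = (5 * 5 ^ q :: nat)" by simp
  finally show ?thesis unfolding digit_def by (simp add: mod_mod_cancel)
qed (simp add: digit_def)

lemma digit_top:
  assumes "j < n * 5 ^ Suc m"
  shows "digit n m j = j div (n * 5 ^ m)"
proof -
  have "j div (n * 5 ^ m) < 5"
    using assms by (simp add: less_mult_imp_div_less mult_ac)
  then show ?thesis by (simp add: digit_def div_mult2_eq)
qed

definition angle :: "nat \<Rightarrow> nat \<Rightarrow> nat \<Rightarrow> real" where
  "angle m n j = 2 * pi * real j / real (n * 5 ^ m)"

lemma Aset_eq: "Aset m n = angle m n ` {..<n * 5 ^ m}"
  by (auto simp: Aset_def angle_def)

lemma cis_angle_inj:
  assumes "cis (angle m n i) = cis (angle m n j)" "i < n * 5 ^ m" "j < n * 5 ^ m"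
  shows "i = j"
proof -
  define N where "N = n * 5 ^ m"
  have N: "i < N" "j < N" using assms(2,3) by (simp_all add: N_def)
  then have N0: "real N > 0" by simp
  obtain z :: int where "angle m n i = angle m n j + 2 * pi * z"
    using assms(1) sin_cos_eq_iff[of "angle m n i" "angle m n j"] by (auto simp: complex_eq_iff)
  then have "2 * pi * (real i / real N) = 2 * pi * (real j / real N + real_of_int z)"
    by (simp add: angle_def N_def distrib_left)
  then have "real i / real N = real j / real N + real_of_int z"
    by (subst (asm) mult_cancel_left) simp
  then have "real i = real j + real_of_int z * real N"
    using N0 by (simp add: field_simps)
  then have e: "int i = int j + z * int N" by (metis (mono_tags, lifting) of_int_add of_int_eq_iff of_int_mult of_int_of_nat_eq)
  have "z = 0"
  proof (rule ccontr)
    assume "z \<noteq> 0"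
    then have "z \<ge> 1 \<or> z \<le> -1" by linarith
    then have "z * int N \<ge> int N \<or> z * int N \<le> - int N"
      using N0 mult_right_mono[of 1 z "int N"] mult_right_mono[of z "-1" "int N"] by auto
    then show False using e N by linarith
  qed
  then show ?thesis using e by simp
qed

text \<open>Modulo full turns the multiplied angle is \<open>2 * pi * (s + \<rho> / D) / 5\<close>
  with \<open>\<rho> / D\<close> in [0, 1). It is therefore within pi/5 < pi/4 of the midpoint of
  the arc of digit \<open>s\<close>, and \<open>sqrt (1/2)\<close> is the cosine of pi/4.\<close>

lemma angle_arc:
  assumes "e < m" "n > 0"
  shows "sqrt (1/2) < Re (cis (5 ^ (m - 1 - e) * angle m n j) * cnj (cis (2 * pi * (real (digit n e j) + 1/2) / 5)))"
proof -
  define D where "D = n * 5 ^ e"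
  define s where "s = digit n e j"
  define \<rho> where "\<rho> = j mod D"
  define M where "M = j div D div 5"
  have D: "real D > 0" using assms(2) by (simp add: D_def)
  have "j = j div D * D + \<rho>" by (simp add: \<rho>_def)
  also have "j div D = 5 * M + s" unfolding M_def s_def D_def digit_def by (simp add: div_mult2_eq)
  finally have j: "real j = (5 * real M + real s) * real D + real \<rho>"
    by (metis of_nat_add of_nat_mult of_nat_numeral)
  have "\<rho> < D" using D by (simp add: \<rho>_def)
  have m: "m = (m - 1 - e) + Suc e" using assms(1) by simp
  have "5 ^ (m - 1 - e) * angle m n j = 2 * pi * real j / (5 * real D)"
    unfolding angle_def D_def by (subst (2) m, subst power_add) simp
  also have "\<dots> = 2 * pi * real M + 2 * pi * (real s + real \<rho> / real D) / 5"
    unfolding j using D by (simp add: field_simps)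
  finally have A: "5 ^ (m - 1 - e) * angle m n j = 2 * pi * real M + 2 * pi * (real s + real \<rho> / real D) / 5" .
  have sqrt_half: "sqrt (1/2) = cos (pi / 4)"
    by (rule real_sqrt_unique) (simp_all add: cos_45 power_divide)
  define x where "x = 2 * pi * (real \<rho> / real D - 1/2) / 5"
  have "Re (cis (5 ^ (m - 1 - e) * angle m n j) * cnj (cis (2 * pi * (real s + 1/2) / 5)))
      = cos (5 ^ (m - 1 - e) * angle m n j - 2 * pi * (real s + 1/2) / 5)"
    by (simp add: cis_cnj cis_mult)
  also have "5 ^ (m - 1 - e) * angle m n j - 2 * pi * (real s + 1/2) / 5 = x + real M * (2 * pi)"
    unfolding A x_def by (simp add: field_simps)
  also have "cos (x + real M * (2 * pi)) = cos x"
    using cos.plus_of_nat[of x M] by simp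
  also have "cos x = cos \<bar>x\<bar>" by simp
  also have "cos \<bar>x\<bar> > cos (pi / 4)"
  proof (rule cos_monotone_0_pi)
    have "0 \<le> real \<rho> / real D" "real \<rho> / real D < 1" using D \<open>\<rho> < D\<close> by auto
    then have "\<bar>real \<rho> / real D - 1/2\<bar> \<le> 1/2" by linarith
    then have "2 * pi * \<bar>real \<rho> / real D - 1/2\<bar> / 5 \<le> 2 * pi * (1/2) / 5"
      by (intro divide_right_mono mult_left_mono) auto
    moreover have "\<bar>x\<bar> = 2 * pi * \<bar>real \<rho> / real D - 1/2\<bar> / 5" by (simp add: x_def abs_mult)
    ultimately have "\<bar>x\<bar> \<le> pi / 5" by simp
    then show "\<bar>x\<bar> < pi / 4" using pi_gt_zero by linarith
  qed (use pi_gt_zero in auto)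
  finally show ?thesis unfolding s_def sqrt_half .
qed

section \<open>Linear functionals along the curve\<close>

text \<open>The highest frequency in \<open>U (3 * k)\<close> is \<open>6 * k - 1\<close>, exactly
  the degree available for the peaks.\<close>

lemma ex_Psi_functional_level:
  assumes "trig_poly (6 * k - 1) v" "i \<le> m" "k > 0"
  shows "\<exists>a. \<forall>t. (\<Sum>c<6 * k * (m + 1). a c * Psi k m t c) = v (5 ^ i * t)"
  using assms(1)
proof (induction rule: trig_poly.induct)
  case (trig_monom h a b)
  have "odd h" using trig_monom(2) assms(3) by simp
  then obtain u where u: "h = 2 * u + 1" by (elim oddE)
  \<comment> \<open>Level \<open>i\<close> occupies a block of \<open>6 * k\<close> coordinates, and
    within it frequency \<open>2 * u + 1\<close> has its cosine at offset \<open>2 * u\<close> and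
    its sine right after.\<close>
  define p where "p = 6 * k * i + 2 * u"
  have u6: "2 * u + 1 < 6 * k" using trig_monom(1) assms(3) u by linarith
  have le: "6 * k * i + 6 * k \<le> 6 * k * (m + 1)"
    using assms(2) by (metis add.commute add_le_mono1 mult_le_mono2 mult_Suc_right Suc_eq_plus1 Suc_le_mono)
  have "p + 1 < 6 * k * (m + 1)"
    by (rule less_le_trans[OF _ le]) (use u6 in \<open>simp add: p_def\<close>)
  then have p: "p < 6 * k * (m + 1)" "p + 1 < 6 * k * (m + 1)" by simp_all
  have dm: "(6 * k * i + v) div (6 * k) = i" "(6 * k * i + v) mod (6 * k) = v" if "v < 6 * k" for v
    using that by simp_all
  have div: "p div (6 * k) = i" "(p + 1) div (6 * k) = i"
    and md: "p mod (6 * k) = 2 * u" "(p + 1) mod (6 * k) = 2 * u + 1"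
    using dm[of "2 * u"] dm[of "2 * u + 1"] u6 by (simp_all add: p_def)
  have P: "Psi k m t p = cos (real h * (5 ^ i * t))" "Psi k m t (p + 1) = sin (real h * (5 ^ i * t))" for t
    unfolding Psi_def U_def div md using p u6 by (simp_all add: u)
  define w where "w = (\<lambda>c. (if c = p then a else 0) + (if c = p + 1 then b else 0))"
  have "(\<Sum>c<6 * k * (m + 1). w c * Psi k m t c) = a * Psi k m t p + b * Psi k m t (p + 1)" for t
  proof -
    have "(\<Sum>c<6 * k * (m + 1). w c * Psi k m t c)
       = (\<Sum>c<6 * k * (m + 1). if c = p then a * Psi k m t c else 0)
       + (\<Sum>c<6 * k * (m + 1). if c = p + 1 then b * Psi k m t c else 0)"
      unfolding sum.distrib[symmetric] by (intro sum.cong) (auto simp: w_def)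
    then show ?thesis using p by simp
  qed
  then show ?case unfolding P by (intro exI[of _ w]) simp
next
  case (trig_add f g)
  then obtain a b where "\<forall>t. (\<Sum>c<6 * k * (m + 1). a c * Psi k m t c) = f (5 ^ i * t)"
    "\<forall>t. (\<Sum>c<6 * k * (m + 1). b c * Psi k m t c) = g (5 ^ i * t)" by blast
  then show ?case
    by (intro exI[of _ "\<lambda>c. a c + b c"]) (simp add: distrib_right sum.distrib)
qed

lemma ex_Psi_functional:
  assumes "\<And>l. trig_poly (6 * k - 1) (g l)" "i \<le> m" "k > 0"
  shows "\<exists>a. \<forall>t. (\<Sum>c<6 * k * (m + 1). a c * Psi k m t c) = (\<Sum>l=0..i. g l (5 ^ l * t))"
proof -
  have "\<forall>l\<in>{0..i}. \<exists>a. \<forall>t. (\<Sum>c<6 * k * (m + 1). a c * Psi k m t c) = g l (5 ^ l * t)"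
    using ex_Psi_functional_level assms by auto
  then obtain a where a: "\<And>l t. l \<in> {0..i} \<Longrightarrow> (\<Sum>c<6 * k * (m + 1). a l c * Psi k m t c) = g l (5 ^ l * t)"
    by metis
  have "(\<Sum>c<6 * k * (m + 1). (\<Sum>l=0..i. a l c) * Psi k m t c) = (\<Sum>l=0..i. g l (5 ^ l * t))" for t
    unfolding sum_distrib_right by (subst sum.swap) (intro sum.cong refl a)
  then show ?thesis by (intro exI[of _ "\<lambda>c. \<Sum>l=0..i. a l c"]) blast
qed

text \<open>A common digit \<open>e\<close> puts the points of \<open>J\<close> into one arc at
  level \<open>m - 1 - e\<close>. The descent from there ends at level 0, where \<open>cis\<close>
  distinguishes the indices.\<close>

lemma ex_Psi_peak:
  assumes "k > 0" "n > 0" "J \<subseteq> {..<n * 5 ^ m}" "J \<noteq> {}" "card J \<le> k" "e < m"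
    and s: "\<And>j. j \<in> J \<Longrightarrow> digit n e j = s"
  shows "\<exists>a. \<forall>j<n * 5 ^ m. (\<Sum>c<6 * k * (m + 1). a c * Psi k m (angle m n j) c) \<le> 1 \<and>
     ((\<Sum>c<6 * k * (m + 1). a c * Psi k m (angle m n j) c) = 1 \<longleftrightarrow> j \<in> J)"
proof -
  have "finite J" using assms(3) finite_subset by blast
  define w where "w = cis (2 * pi * (real s + 1/2) / 5)"
  obtain g where g: "\<And>l. trig_poly (6 * k - 1) (g l)"
    "\<forall>t\<in>angle m n ` {..<n * 5 ^ m}. (\<Sum>l=0..m - 1 - e. g l (5 ^ l * t)) \<le> 1 \<and>
      ((\<Sum>l=0..m - 1 - e. g l (5 ^ l * t)) = 1 \<longleftrightarrow> cis (5 ^ 0 * t) \<in> (\<lambda>s. cis (5 ^ 0 * s)) ` angle m n ` J)"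
  proof -
    have "card (angle m n ` J) \<le> k" using card_image_le[OF \<open>finite J\<close>, of "angle m n"] assms(5) by simp
    moreover have "sqrt (1/2) < Re (cis (5 ^ (m - 1 - e) * t) * cnj w)" if "t \<in> angle m n ` J" for t
      using that angle_arc[OF assms(6,2)] s unfolding w_def by fastforce
    moreover have "norm w = 1" by (simp add: w_def)
    ultimately show ?thesis
      using ex_levels_peak[of "angle m n ` {..<n * 5 ^ m}" "angle m n ` J" k w "m - 1 - e" 0] assms(3,4) that by blast
  qed
  obtain a where a: "\<And>t. (\<Sum>c<6 * k * (m + 1). a c * Psi k m t c) = (\<Sum>l=0..m - 1 - e. g l (5 ^ l * t))"
    using ex_Psi_functional[of k g "m - 1 - e" m] g(1) assms(1) by auto
  have "cis (5 ^ 0 * angle m n j) \<in> (\<lambda>s. cis (5 ^ 0 * s)) ` angle m n ` J \<longleftrightarrow> j \<in> J" if "j < n * 5 ^ m" for j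
    using cis_angle_inj[of m n j] that assms(3) by auto
  then have "\<forall>j<n * 5 ^ m. (\<Sum>l=0..m - 1 - e. g l (5 ^ l * angle m n j)) \<le> 1 \<and>
      ((\<Sum>l=0..m - 1 - e. g l (5 ^ l * angle m n j)) = 1 \<longleftrightarrow> j \<in> J)"
    using g(2) by auto
  then show ?thesis unfolding a[symmetric] by blast
qed

section \<open>Faces and vertices of the polytope \<open>Qpoly\<close>\<close>

definition Qvert :: "nat \<Rightarrow> nat \<Rightarrow> nat \<Rightarrow> nat \<times> nat \<Rightarrow> nat \<Rightarrow> real" where
  "Qvert k m n p = embed (6 * k * (m + 1)) (fst p) (Psi k m (angle m n (snd p)))"

lemma linear_embed: "linear (embed D l)"
  by (rule linearI) (auto simp: embed_def scaleR_fun_def fun_eq_iff)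

lemma linear_functional: "linear (\<lambda>x. \<Sum>i<(d::nat). a i * x i :: real)"
  by (rule linearI) (auto simp: scaleR_fun_def distrib_left sum.distrib sum_distrib_left mult_ac)

lemma Qpoly_eq: "Qpoly k m n r = convex hull (Qvert k m n ` ({..<r} \<times> {..<n * 5 ^ m}))"
proof -
  let ?V = "Qvert k m n ` ({..<r} \<times> {..<n * 5 ^ m})"
  have *: "embed (6 * k * (m + 1)) l ` Ppoly k m n = convex hull ((\<lambda>j. Qvert k m n (l, j)) ` {..<n * 5 ^ m})" for l
    unfolding Ppoly_def Aset_eq convex_hull_linear_image[OF linear_embed] image_image Qvert_def fst_conv snd_conv ..
  show ?thesis
  proof
    show "Qpoly k m n r \<subseteq> convex hull ?V"
      unfolding Qpoly_def *
      by (rule hull_minimal) (auto intro!: UN_least hull_mono convex_convex_hull simp del: UN_simps)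
    show "convex hull ?V \<subseteq> Qpoly k m n r"
      unfolding Qpoly_def *
    proof (rule hull_mono, rule subsetI)
      fix x assume "x \<in> ?V"
      then obtain l j where "l < r" "j < n * 5 ^ m" "x = Qvert k m n (l, j)" by auto
      then show "x \<in> (\<Union>l<r. convex hull ((\<lambda>j. Qvert k m n (l, j)) ` {..<n * 5 ^ m}))"
        by (intro UN_I[of l] hull_inc) auto
    qed
  qed
qed

lemma functional_embed:
  assumes "l < r"
  shows "(\<Sum>i<D * r. a (i div D) (i mod D) * embed D l x i) = (\<Sum>c<D. a l c * x c :: real)"
proof -
  have sub: "(\<lambda>c. l * D + c) ` {..<D} \<subseteq> {..<D * r}"
  proof
    fix i assume "i \<in> (\<lambda>c. l * D + c) ` {..<D}"
    then have "i < Suc l * D" by auto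
    also have "\<dots> \<le> r * D" using assms by (intro mult_le_mono1) simp
    finally show "i \<in> {..<D * r}" by (simp add: mult.commute)
  qed
  have zero: "embed D l x i = 0" if "i \<notin> (\<lambda>c. l * D + c) ` {..<D}" for i
  proof -
    have "\<not> (l * D \<le> i \<and> i < (l + 1) * D)"
    proof
      assume "l * D \<le> i \<and> i < (l + 1) * D"
      then have "i = l * D + (i - l * D)" "i - l * D < D" by auto
      then show False using that by blast
    qed
    then show ?thesis by (auto simp: embed_def)
  qed
  have "(\<Sum>i<D * r. a (i div D) (i mod D) * embed D l x i)
     = (\<Sum>i\<in>(\<lambda>c. l * D + c) ` {..<D}. a (i div D) (i mod D) * embed D l x i)"
    using sub zero by (intro sum.mono_neutral_right) auto
  also have "\<dots> = (\<Sum>c<D. a ((l * D + c) div D) ((l * D + c) mod D) * embed D l x (l * D + c))"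
    by (subst sum.reindex) (auto simp: inj_on_def)
  also have "\<dots> = (\<Sum>c<D. a l c * x c)"
    by (intro sum.cong refl) (auto simp: embed_def)
  finally show ?thesis .
qed

text \<open>If a convex combination attains the bound, the nonnegative terms
  \<open>u v * (b - \<phi> v)\<close> sum to 0, so all its weight is on \<open>G\<close>.\<close>

lemma convex_hull_functional_face:
  fixes V :: "'a::real_vector set" and \<phi> :: "'a \<Rightarrow> real"
  assumes "finite V" "linear \<phi>" "G \<subseteq> V" and "\<And>v. v \<in> V \<Longrightarrow> \<phi> v \<le> b \<and> (\<phi> v = b \<longleftrightarrow> v \<in> G)"
  shows "\<And>x. x \<in> convex hull V \<Longrightarrow> \<phi> x \<le> b"
    and "convex hull G = {x \<in> convex hull V. \<phi> x = b}"
proof -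
  interpret linear \<phi> by fact
  have cle: "convex {x. \<phi> x \<le> b}" and ceq: "convex {x. \<phi> x = b}"
    using convex_linear_vimage[OF assms(2), of "{..b}"] convex_linear_vimage[OF assms(2), of "{b}"]
    by (auto simp: vimage_def)
  have "convex hull V \<subseteq> {x. \<phi> x \<le> b}" by (rule hull_minimal) (use assms(4) cle in auto)
  then show "\<And>x. x \<in> convex hull V \<Longrightarrow> \<phi> x \<le> b" by blast
  have "convex hull G \<subseteq> {x. \<phi> x = b}" by (rule hull_minimal) (use assms(3,4) ceq in auto)
  moreover have "convex hull G \<subseteq> convex hull V" by (rule hull_mono[OF assms(3)])
  moreover have "x \<in> convex hull G" if x: "x \<in> convex hull V" "\<phi> x = b" for x
  proof -
    obtain u where u: "\<And>v. v \<in> V \<Longrightarrow> 0 \<le> u v" "sum u V = 1" "(\<Sum>v\<in>V. u v *\<^sub>R v) = x"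
      using x(1) unfolding convex_hull_finite[OF assms(1)] by blast
    have "(\<Sum>v\<in>V. u v * (b - \<phi> v)) = b * sum u V - \<phi> (\<Sum>v\<in>V. u v *\<^sub>R v)"
      by (simp add: sum scale right_diff_distrib sum_subtractf sum_distrib_left mult.commute)
    also have "\<dots> = 0" using u(2,3) x(2) by simp
    finally have "\<forall>v\<in>V. u v * (b - \<phi> v) = 0"
      using u(1) assms(4) by (subst (asm) sum_nonneg_eq_0_iff[OF assms(1)]) auto
    then have u0: "u v = 0" if "v \<in> V - G" for v using that assms(4) by force
    have "sum u G = 1" using u(2) sum.mono_neutral_left[OF assms(1,3), of u] u0 by simp
    moreover have "(\<Sum>v\<in>G. u v *\<^sub>R v) = x"
      using u(3) sum.mono_neutral_left[OF assms(1,3), of "\<lambda>v. u v *\<^sub>R v"] u0 by simp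
    moreover have "finite G" using assms(1,3) finite_subset by blast
    ultimately show ?thesis using u(1) assms(3) unfolding convex_hull_finite[OF \<open>finite G\<close>] by blast
  qed
  ultimately show "convex hull G = {x \<in> convex hull V. \<phi> x = b}" by blast
qed

text \<open>Every copy has its own block of coordinates, so functionals for the copies can be chosen
  separately. All peaks have height 1, which makes the glued functional attain its maximum in all
  copies that meet \<open>G\<close>.\<close>

lemma ex_Q_functional:
  assumes "k > 0" "n > 0" "G \<subseteq> {..<r} \<times> {..<n * 5 ^ m}" "G \<noteq> {}"
    and good: "\<And>l. l \<in> fst ` G \<Longrightarrow> card {j. (l, j) \<in> G} \<le> k \<and>
      (\<exists>e<m. \<exists>s. \<forall>j. (l, j) \<in> G \<longrightarrow> digit n e j = s)"
  shows "\<exists>a. (\<exists>i<6 * k * r * (m + 1). a i \<noteq> 0) \<and>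
     (\<forall>p\<in>{..<r} \<times> {..<n * 5 ^ m}. (\<Sum>i<6 * k * r * (m + 1). a i * Qvert k m n p i) \<le> (1::real) \<and>
        ((\<Sum>i<6 * k * r * (m + 1). a i * Qvert k m n p i) = 1 \<longleftrightarrow> p \<in> G))"
proof -
  define D where "D = 6 * k * (m + 1)"
  have d: "6 * k * r * (m + 1) = D * r" by (simp add: D_def algebra_simps)
  have "\<exists>a. \<forall>j<n * 5 ^ m. (\<Sum>c<D. a c * Psi k m (angle m n j) c) \<le> 1 \<and>
     ((\<Sum>c<D. a c * Psi k m (angle m n j) c) = 1 \<longleftrightarrow> (l, j) \<in> G)" for l
  proof (cases "l \<in> fst ` G")
    case True
    define J where "J = {j. (l, j) \<in> G}"
    obtain e s where es: "e < m" "\<forall>j\<in>J. digit n e j = s" using good[OF True] by (auto simp: J_def)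
    have "J \<subseteq> {..<n * 5 ^ m}" "J \<noteq> {}" "card J \<le> k" using assms(3) good[OF True] True by (auto simp: J_def)
    from ex_Psi_peak[OF assms(1,2) this es(1), of s] es(2) show ?thesis by (simp add: D_def J_def)
  next
    case False
    then have "(l, j) \<notin> G" for j by force
    \<comment> \<open>On a copy without points of \<open>G\<close> the zero functional stays
      strictly below 1.\<close>
    then show ?thesis by (intro exI[of _ "\<lambda>_. 0"]) simp
  qed
  then obtain a where a: "\<And>l j. j < n * 5 ^ m \<Longrightarrow> (\<Sum>c<D. a l c * Psi k m (angle m n j) c) \<le> 1 \<and>
     ((\<Sum>c<D. a l c * Psi k m (angle m n j) c) = 1 \<longleftrightarrow> (l, j) \<in> G)" by metis
  define a' where "a' = (\<lambda>i. a (i div D) (i mod D))"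
  have val: "(\<Sum>i<D * r. a' i * Qvert k m n (l, j) i) = (\<Sum>c<D. a l c * Psi k m (angle m n j) c)" if "l < r" for l j
    unfolding a'_def Qvert_def fst_conv snd_conv D_def[symmetric] by (rule functional_embed[OF that])
  have *: "(\<Sum>i<D * r. a' i * Qvert k m n p i) \<le> 1 \<and> ((\<Sum>i<D * r. a' i * Qvert k m n p i) = 1 \<longleftrightarrow> p \<in> G)"
    if p: "p \<in> {..<r} \<times> {..<n * 5 ^ m}" for p
  proof -
    obtain l j where "p = (l, j)" "l < r" "j < n * 5 ^ m" using p by auto
    then show ?thesis using a val by simp
  qed
  obtain p where "p \<in> G" using assms(4) by blast
  then have "(\<Sum>i<D * r. a' i * Qvert k m n p i) = 1" using * assms(3) by blast
  then have "\<exists>i<D * r. a' i \<noteq> 0" by (metis (no_types, lifting) lessThan_iff mult_zero_left sum.neutral zero_neq_one)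
  then show ?thesis using * unfolding d by blast
qed

lemma Q_face:
  assumes "k > 0" "n > 0" "G \<subseteq> {..<r} \<times> {..<n * 5 ^ m}" "G \<noteq> {}"
    and "\<And>l. l \<in> fst ` G \<Longrightarrow> card {j. (l, j) \<in> G} \<le> k \<and>
      (\<exists>e<m. \<exists>s. \<forall>j. (l, j) \<in> G \<longrightarrow> digit n e j = s)"
  shows "is_face (6 * k * r * (m + 1)) (convex hull (Qvert k m n ` G)) (Qpoly k m n r)"
proof -
  let ?d = "6 * k * r * (m + 1)" and ?V = "Qvert k m n ` ({..<r} \<times> {..<n * 5 ^ m})"
  obtain a where a: "\<exists>i<?d. a i \<noteq> 0"
    "\<And>p. p \<in> {..<r} \<times> {..<n * 5 ^ m} \<Longrightarrow> (\<Sum>i<?d. a i * Qvert k m n p i) \<le> (1::real) \<and>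
        ((\<Sum>i<?d. a i * Qvert k m n p i) = 1 \<longleftrightarrow> p \<in> G)"
    using ex_Q_functional[OF assms] by blast
  have V: "(\<Sum>i<?d. a i * v i) \<le> 1 \<and> ((\<Sum>i<?d. a i * v i) = 1 \<longleftrightarrow> v \<in> Qvert k m n ` G)" if "v \<in> ?V" for v
    using that a(2) assms(3) by blast
  note face = convex_hull_functional_face[OF _ linear_functional[of a ?d] image_mono[OF assms(3)] V]
  have "convex hull (Qvert k m n ` G) \<noteq> {}" using assms(4) by simp
  then show ?thesis
    unfolding is_face_def Qpoly_eq
    by (intro exI[of _ a] exI[of _ 1] conjI a(1) ballI face) auto
qed

text \<open>A single point trivially satisfies the conditions of \<open>ex_Q_functional\<close>, so
  each \<open>Qvert k m n p\<close> is the unique maximizer of some functional. This yields both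
  distinctness and extremality.\<close>

lemma Q_vertices:
  assumes "k > 0" "n > 0" "m > 0"
  shows "inj_on (Qvert k m n) ({..<r} \<times> {..<n * 5 ^ m})"
    and "vertices (Qpoly k m n r) = Qvert k m n ` ({..<r} \<times> {..<n * 5 ^ m})"
proof -
  let ?d = "6 * k * r * (m + 1)" and ?I = "{..<r} \<times> {..<n * 5 ^ m}"
  let ?V = "Qvert k m n ` ?I"
  have sep: "\<exists>a. \<forall>q\<in>?I. (\<Sum>i<?d. a i * Qvert k m n q i) \<le> (1::real) \<and>
      ((\<Sum>i<?d. a i * Qvert k m n q i) = 1 \<longleftrightarrow> q \<in> {p})" if p: "p \<in> ?I" for p
  proof -
    have "\<exists>a. (\<exists>i<?d. a i \<noteq> 0) \<and> (\<forall>q\<in>?I. (\<Sum>i<?d. a i * Qvert k m n q i) \<le> (1::real) \<and>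
      ((\<Sum>i<?d. a i * Qvert k m n q i) = 1 \<longleftrightarrow> q \<in> {p}))"
    proof (rule ex_Q_functional[OF assms(1,2)])
      fix l assume "l \<in> fst ` {p}"
      then have "{j. (l, j) \<in> {p}} = {snd p}" by (auto simp: prod_eq_iff)
      then have "card {j. (l, j) \<in> {p}} \<le> k" using assms(1) by simp
      moreover have "\<forall>j. (l, j) \<in> {p} \<longrightarrow> digit n 0 j = digit n 0 (snd p)" by auto
      ultimately show "card {j. (l, j) \<in> {p}} \<le> k \<and>
        (\<exists>e<m. \<exists>s. \<forall>j. (l, j) \<in> {p} \<longrightarrow> digit n e j = s)"
        using assms(3) by blast
    qed (use p in auto)
    then show ?thesis by blast
  qed
  show "inj_on (Qvert k m n) ?I"
  proof (rule inj_onI)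
    fix p q assume "p \<in> ?I" "q \<in> ?I" "Qvert k m n p = Qvert k m n q"
    then show "p = q" using sep[of p] by (metis singleton_iff)
  qed
  have "Qvert k m n p extreme_point_of convex hull ?V" if p: "p \<in> ?I" for p
  proof -
    obtain a where a: "\<And>q. q \<in> ?I \<Longrightarrow> (\<Sum>i<?d. a i * Qvert k m n q i) \<le> (1::real) \<and>
      ((\<Sum>i<?d. a i * Qvert k m n q i) = 1 \<longleftrightarrow> q \<in> {p})" using sep[OF p] by blast
    define \<phi> where "\<phi> = (\<lambda>x. \<Sum>i<?d. a i * x i)"
    have lin: "linear \<phi>" unfolding \<phi>_def by (rule linear_functional)
    have V: "\<phi> v \<le> 1 \<and> (\<phi> v = 1 \<longleftrightarrow> v \<in> {Qvert k m n p})" if "v \<in> ?V" for v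
      using that a p unfolding \<phi>_def by blast
    have "finite ?V" "{Qvert k m n p} \<subseteq> ?V" using p by auto
    note face = convex_hull_functional_face[OF this(1) lin this(2) V]
    show ?thesis
      unfolding extreme_point_of_def
    proof (intro conjI ballI notI)
      show "Qvert k m n p \<in> convex hull ?V" using p by (intro hull_inc) auto
      fix x y assume xy: "x \<in> convex hull ?V" "y \<in> convex hull ?V" "Qvert k m n p \<in> open_segment x y"
      obtain u where u: "0 < u" "u < 1" "Qvert k m n p = (1 - u) *\<^sub>R x + u *\<^sub>R y" "x \<noteq> y"
        using xy(3) unfolding in_segment by blast
      have "\<phi> (Qvert k m n p) = 1" using V p by blast
      then have "1 = (1 - u) * \<phi> x + u * \<phi> y"
        using arg_cong[OF u(3), of \<phi>] by (simp add: linear_add[OF lin] linear_scale[OF lin])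
      then have "(1 - u) * (1 - \<phi> x) + u * (1 - \<phi> y) = 0" by (simp add: algebra_simps)
      moreover have "0 \<le> (1 - u) * (1 - \<phi> x)" "0 \<le> u * (1 - \<phi> y)" using face(1) xy(1,2) u by simp_all
      ultimately have "(1 - u) * (1 - \<phi> x) = 0" "u * (1 - \<phi> y) = 0" by linarith+
      then have "\<phi> x = 1" "\<phi> y = 1" using u by simp_all
      moreover have "{Qvert k m n p} = {x \<in> convex hull ?V. \<phi> x = 1}" using face(2) by simp
      ultimately have "x \<in> {Qvert k m n p}" "y \<in> {Qvert k m n p}" using xy(1,2) by simp_all
      then show False using u(4) by simp
    qed
  qed
  then show "vertices (Qpoly k m n r) = ?V"
    unfolding vertices_def Qpoly_eq using extreme_point_of_convex_hull by blast
qed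

section \<open>Counting good draws\<close>

lemma real_card_Diff:
  assumes "finite E" "G \<subseteq> E"
  shows "real (card (E - G)) = real (card E) - real (card G)"
  using assms finite_subset[OF assms(2,1)] by (simp add: card_Diff_subset card_mono of_nat_diff)

lemma card_PiE_fixed:
  assumes "finite I" "S \<subseteq> I" "a \<in> A"
  shows "card {f \<in> PiE I (\<lambda>_. A). \<forall>i\<in>S. f i = a} = card A ^ (card I - card S)"
proof -
  have "finite S" using assms finite_subset by blast
  have "{f \<in> PiE I (\<lambda>_. A). \<forall>i\<in>S. f i = a} = PiE I (\<lambda>i. if i \<in> S then {a} else A)"
  proof (intro equalityI subsetI)
    fix f assume "f \<in> {f \<in> PiE I (\<lambda>_. A). \<forall>i\<in>S. f i = a}"
    then show "f \<in> PiE I (\<lambda>i. if i \<in> S then {a} else A)" by (auto simp: PiE_iff)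
  next
    fix f assume f: "f \<in> PiE I (\<lambda>i. if i \<in> S then {a} else A)"
    have "f i = a" if "i \<in> S" for i using PiE_mem[OF f, of i] that assms(2) by auto
    moreover have "f i \<in> A" if "i \<in> I" for i using PiE_mem[OF f that] assms(3) by (auto split: if_splits)
    ultimately show "f \<in> {f \<in> PiE I (\<lambda>_. A). \<forall>i\<in>S. f i = a}" using f by (simp add: PiE_iff)
  qed
  also have "card \<dots> = (\<Prod>i\<in>I. if i \<in> S then 1 else card A)"
    using assms(1) by (simp add: card_PiE if_distrib cong: if_cong)
  also have "\<dots> = (\<Prod>i\<in>I - S. card A)"
    using assms(1) by (subst prod.mono_neutral_cong_right[of I "I - S"]) auto
  also have "\<dots> = card A ^ (card I - card S)"
    using assms \<open>finite S\<close> by (simp add: card_Diff_subset)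
  finally show ?thesis .
qed

text \<open>The complement splits by the common value on \<open>S\<close> into 5 classes of
  \<open>5 ^ (card I - card S)\<close> functions each. As \<open>S\<close> is nonempty,
  \<open>card S - 1\<close> is a true difference.\<close>

lemma card_PiE_nonconstant:
  assumes "finite I" "S \<subseteq> I" "S \<noteq> {}"
  shows "real (card {f \<in> PiE I (\<lambda>_. {..<5::nat}). \<not> (\<exists>s. \<forall>i\<in>S. f i = s)})
       = 5 ^ card I * (1 - 1 / 5 ^ (card S - 1))"
proof -
  let ?E = "PiE I (\<lambda>_. {..<5::nat})"
  define K where "K = (\<lambda>s. {f \<in> ?E. \<forall>i\<in>S. f i = s})"
  have fS: "finite S" using assms finite_subset by blast
  have fE: "finite ?E" using assms(1) by (intro finite_PiE) auto
  have S: "0 < card S" "card S \<le> card I" using assms fS by (auto simp: card_gt_0_iff card_mono)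
  have "card (\<Union>s<5. K s) = (\<Sum>s<5. card (K s))"
    using fE assms(3) by (intro card_UN_disjoint) (auto simp: K_def)
  also have "\<dots> = (\<Sum>s<5::nat. 5 ^ (card I - card S))"
    unfolding K_def using card_PiE_fixed[OF assms(1,2), of _ "{..<5::nat}"] by (intro sum.cong) auto
  finally have c: "card (\<Union>s<5. K s) = 5 * 5 ^ (card I - card S)" by simp
  have "{f \<in> ?E. \<not> (\<exists>s. \<forall>i\<in>S. f i = s)} = ?E - (\<Union>s<5. K s)"
  proof (intro equalityI subsetI)
    fix f assume f: "f \<in> ?E - (\<Union>s<5. K s)"
    have "\<not> (\<exists>s. \<forall>i\<in>S. f i = s)"
    proof
      assume "\<exists>s. \<forall>i\<in>S. f i = s"
      then obtain s where s: "\<forall>i\<in>S. f i = s" by blast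
      moreover have "s < 5" using s assms(2,3) f by (auto simp: PiE_def Pi_def)
      ultimately show False using f by (auto simp: K_def)
    qed
    then show "f \<in> {f \<in> ?E. \<not> (\<exists>s. \<forall>i\<in>S. f i = s)}" using f by blast
  qed (auto simp: K_def)
  moreover have "(\<Union>s<5. K s) \<subseteq> ?E" by (auto simp: K_def)
  moreover have "card ?E = 5 ^ card I" using assms(1) by (simp add: card_PiE)
  ultimately have "real (card {f \<in> ?E. \<not> (\<exists>s. \<forall>i\<in>S. f i = s)}) = 5 ^ card I - real (card (\<Union>s<5. K s))"
    using real_card_Diff[OF fE] by simp
  also have "\<dots> = 5 ^ card I - 5 * 5 ^ (card I - card S)" unfolding c by simp
  also have "(5::real) * 5 ^ (card I - card S) = 5 ^ card I / 5 ^ (card S - 1)"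
  proof -
    have "5 * 5 ^ (card I - card S) * 5 ^ (card S - 1) = (5 ^ Suc (card I - card S + (card S - 1)) :: real)"
      by (simp add: power_add)
    also have "Suc (card I - card S + (card S - 1)) = card I" using S by simp
    finally show ?thesis by (simp add: field_simps)
  qed
  finally show ?thesis by (simp add: right_diff_distrib)
qed

text \<open>Induction on \<open>m\<close>: remainders and quotients modulo \<open>n * 5 ^ m\<close>
  map the tuples injectively to pairs of a bad tuple for \<open>m\<close> and a tuple of top digits
  that is nonconstant on \<open>S\<close>.\<close>

lemma card_no_common_digit_le:
  assumes "finite I" "S \<subseteq> I" "S \<noteq> {}"
  shows "real (card {j \<in> PiE I (\<lambda>_. {..<n * 5 ^ m}). \<forall>e<m. \<not> (\<exists>s. \<forall>i\<in>S. digit n e (j i) = s)})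
       \<le> real (n * 5 ^ m) ^ card I * (1 - 1 / 5 ^ (card S - 1)) ^ m"
proof (induction m)
  case 0
  then show ?case using assms(1) by (simp add: card_PiE)
next
  case (Suc m)
  define B where "B = (\<lambda>m. {j \<in> PiE I (\<lambda>_. {..<n * 5 ^ m}). \<forall>e<m. \<not> (\<exists>s. \<forall>i\<in>S. digit n e (j i) = s)})"
  define NC where "NC = {f \<in> PiE I (\<lambda>_. {..<5::nat}). \<not> (\<exists>s. \<forall>i\<in>S. f i = s)}"
  define \<phi> where "\<phi> = (\<lambda>j::'a \<Rightarrow> nat. (restrict (\<lambda>i. j i mod (n * 5 ^ m)) I, restrict (\<lambda>i. j i div (n * 5 ^ m)) I))"
  have fin: "finite (PiE I (\<lambda>_. {..<a}))" for a :: nat using assms(1) by (intro finite_PiE) auto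
  have fB: "finite (B m)" unfolding B_def by (rule finite_subset[OF _ fin]) auto
  have fNC: "finite NC" unfolding NC_def by (rule finite_subset[OF _ fin]) auto
  have "inj_on \<phi> (B (Suc m))"
  proof (rule inj_onI)
    fix j j' assume j: "j \<in> B (Suc m)" "j' \<in> B (Suc m)" and eq: "\<phi> j = \<phi> j'"
    show "j = j'"
    proof (rule PiE_ext)
      show "j \<in> PiE I (\<lambda>_. {..<n * 5 ^ Suc m})" "j' \<in> PiE I (\<lambda>_. {..<n * 5 ^ Suc m})"
        using j unfolding B_def by blast+
      fix i assume i: "i \<in> I"
      have "j i mod (n * 5 ^ m) = j' i mod (n * 5 ^ m)" "j i div (n * 5 ^ m) = j' i div (n * 5 ^ m)"
        using arg_cong[OF eq, of "\<lambda>p. fst p i"] arg_cong[OF eq, of "\<lambda>p. snd p i"] i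
        by (simp_all add: \<phi>_def)
      then show "j i = j' i" by (metis div_mult_mod_eq)
    qed
  qed
  moreover have "\<phi> ` B (Suc m) \<subseteq> B m \<times> NC"
  proof
    fix p assume "p \<in> \<phi> ` B (Suc m)"
    then obtain j where j: "j \<in> B (Suc m)" "p = \<phi> j" by blast
    have lt: "j i < n * 5 ^ Suc m" if "i \<in> I" for i
      using j(1) that unfolding B_def by auto
    have bad: "\<not> (\<exists>s. \<forall>i\<in>S. digit n e (j i) = s)" if "e < Suc m" for e
      using j(1) that unfolding B_def by blast
    have "fst p \<in> B m"
    proof -
      have "\<not> (\<exists>s. \<forall>i\<in>S. digit n e (fst p i) = s)" if e: "e < m" for e
      proof -
        have "digit n e (fst p i) = digit n e (j i)" if "i \<in> S" for i
          using that assms(2) e by (auto simp: j(2) \<phi>_def digit_mod)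
        then show ?thesis using bad[of e] e by auto
      qed
      moreover have "j i mod (n * 5 ^ m) < n * 5 ^ m" if "i \<in> I" for i
      proof -
        have "n > 0" using lt[OF that] by (cases n) auto
        then show ?thesis by simp
      qed
      then have "fst p \<in> PiE I (\<lambda>_. {..<n * 5 ^ m})"
        unfolding j(2) \<phi>_def by simp
      ultimately show ?thesis unfolding B_def by blast
    qed
    moreover have "snd p \<in> NC"
    proof -
      have top: "snd p i = digit n m (j i)" if "i \<in> I" for i
        using that digit_top[OF lt[OF that]] by (simp add: j(2) \<phi>_def)
      have "\<not> (\<exists>s. \<forall>i\<in>S. snd p i = s)"
        using bad[of m] top assms(2) by (metis lessI subsetD)
      moreover have "snd p \<in> PiE I (\<lambda>_. {..<5})"
      proof (rule PiE_I)
        fix i assume "i \<in> I"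
        then show "snd p i \<in> {..<5}" using top by (simp add: digit_def)
      qed (simp add: j(2) \<phi>_def)
      ultimately show ?thesis unfolding NC_def by blast
    qed
    ultimately show "p \<in> B m \<times> NC" by (simp add: mem_Times_iff)
  qed
  ultimately have "card (B (Suc m)) \<le> card (B m \<times> NC)"
    by (rule card_inj_on_le) (use fB fNC in simp)
  then have "real (card (B (Suc m))) \<le> real (card (B m)) * real (card NC)"
    by (simp add: card_cartesian_product flip: of_nat_mult)
  also have "\<dots> \<le> real (n * 5 ^ m) ^ card I * (1 - 1 / 5 ^ (card S - 1)) ^ m * (5 ^ card I * (1 - 1 / 5 ^ (card S - 1)))"
    unfolding NC_def card_PiE_nonconstant[OF assms]
    by (rule mult_right_mono) (use Suc.IH in \<open>simp_all add: B_def\<close>)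
  also have "\<dots> = real (n * 5 ^ Suc m) ^ card I * (1 - 1 / 5 ^ (card S - 1)) ^ Suc m"
    by (simp add: power_mult_distrib)
  finally show ?case unfolding B_def .
qed

text \<open>Union bound over a value \<open>l\<close> and a set of \<open>k + 1\<close> arguments
  all sent to \<open>l\<close>, combined with
  \<open>(r choose (k + 1)) * fact (k + 1) \<le> r ^ (k + 1)\<close>.\<close>

lemma card_small_fibres_ge:
  shows "real (card {b \<in> PiE {..<r} (\<lambda>_. {..<r}). \<forall>l<r. card {i. i < r \<and> b i = l} \<le> k})
       \<ge> real r ^ r * (1 - real r / fact (k + 1))"
proof -
  let ?E = "PiE {..<r} (\<lambda>_. {..<r})"
  define G where "G = {b \<in> ?E. \<forall>l<r. card {i. i < r \<and> b i = l} \<le> k}"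
  define W where "W = {S. S \<subseteq> {..<r} \<and> card S = k + 1}"
  define K where "K = (\<lambda>(l, S). {b \<in> ?E. \<forall>i\<in>S. b i = (l::nat)})"
  have fE: "finite ?E" by (intro finite_PiE) auto
  have fW: "finite W" unfolding W_def by (rule finite_subset[of _ "Pow {..<r}"]) auto
  have "?E - G \<subseteq> (\<Union>p\<in>{..<r} \<times> W. K p)"
  proof
    fix b assume "b \<in> ?E - G"
    then obtain l where l: "b \<in> ?E" "l < r" "k + 1 \<le> card {i. i < r \<and> b i = l}"
      unfolding G_def by force
    then obtain S where "S \<subseteq> {i. i < r \<and> b i = l}" "card S = k + 1"
      using obtain_subset_with_card_n by metis
    then have "S \<in> W" "b \<in> K (l, S)" using l(1) unfolding W_def K_def by auto
    then show "b \<in> (\<Union>p\<in>{..<r} \<times> W. K p)" using l(2) by blast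
  qed
  moreover have "finite (\<Union>p\<in>{..<r} \<times> W. K p)"
    by (rule finite_subset[OF _ fE]) (auto simp: K_def)
  ultimately have "card (?E - G) \<le> card (\<Union>p\<in>{..<r} \<times> W. K p)" by (intro card_mono)
  also have "\<dots> \<le> (\<Sum>p\<in>{..<r} \<times> W. card (K p))" by (rule card_UN_le) (use fW in simp)
  also have "\<dots> = (\<Sum>p\<in>{..<r} \<times> W. r ^ (r - (k + 1)))"
  proof (intro sum.cong refl)
    fix p assume "p \<in> {..<r} \<times> W"
    then obtain l S where "p = (l, S)" "l < r" "S \<subseteq> {..<r}" "card S = k + 1" by (auto simp: W_def)
    then show "card (K p) = r ^ (r - (k + 1))"
      unfolding K_def using card_PiE_fixed[of "{..<r}" S l "{..<r}"] by simp
  qed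
  also have "\<dots> = r * (r choose (k + 1)) * r ^ (r - (k + 1))"
    unfolding W_def using n_subsets[of "{..<r}" "k + 1"] by (simp add: card_cartesian_product)
  finally have "card (?E - G) * fact (k + 1) \<le> r * ((r choose (k + 1)) * fact (k + 1)) * r ^ (r - (k + 1))"
    by (metis (no_types, lifting) mult.assoc mult.commute mult_le_mono1)
  also have "\<dots> \<le> r * r ^ r"
  proof (cases "k + 1 \<le> r")
    case True
    have "r * ((r choose (k + 1)) * fact (k + 1)) * r ^ (r - (k + 1)) \<le> r * r ^ (k + 1) * r ^ (r - (k + 1))"
      using binomial_fact_pow[of r "k + 1"] by (intro mult_le_mono mult_le_mono1 le_refl)
    also have "\<dots> = r * (r ^ (k + 1 + (r - (k + 1))))" by (simp add: power_add)
    finally show ?thesis using True by simp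
  next
    case False
    then show ?thesis by (simp add: binomial_eq_0)
  qed
  finally have "real (card (?E - G) * fact (k + 1)) \<le> real (r * r ^ r)" by (rule of_nat_mono)
  then have "real (card (?E - G)) \<le> real r ^ r * (real r / fact (k + 1))"
    by (simp add: pos_le_divide_eq mult.commute del: fact_Suc)
  moreover have "real (card (?E - G)) = real (card ?E) - real (card G)"
    by (rule real_card_Diff[OF fE]) (auto simp: G_def)
  moreover have "card ?E = r ^ r" by (simp add: card_PiE)
  ultimately show ?thesis unfolding G_def[symmetric] by (simp add: right_diff_distrib)
qed

section \<open>Good draws of vertices\<close>

text \<open>Draw \<open>i\<close> is encoded as vertex number \<open>j i\<close> of copy
  \<open>b i\<close>; the predicate concerns the draws that land in copy \<open>l\<close>.\<close>

definition good_draw :: "nat \<Rightarrow> nat \<Rightarrow> nat \<Rightarrow> nat \<Rightarrow> (nat \<Rightarrow> nat) \<Rightarrow> (nat \<Rightarrow> nat) \<Rightarrow> bool" where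
  "good_draw m n r l b j \<longleftrightarrow> (\<exists>e<m. \<exists>s. \<forall>i. i < r \<and> b i = l \<longrightarrow> digit n e (j i) = s)"

text \<open>For a fixed distribution \<open>b\<close>, a union bound over the copies. The failure
  bound grows with the number of draws in a copy, so its value at \<open>k\<close> serves for
  all.\<close>

lemma card_common_digits_ge:
  assumes "m > 0" "k > 0" "\<And>l. l < r \<Longrightarrow> card {i. i < r \<and> b i = l} \<le> k"
  shows "real (card {j \<in> PiE {..<r} (\<lambda>_. {..<n * 5 ^ m}). \<forall>l<r. good_draw m n r l b j})
       \<ge> real (n * 5 ^ m) ^ r * (1 - real r * (1 - 1 / 5 ^ (k - 1)) ^ m)"
proof -
  let ?E = "PiE {..<r} (\<lambda>_. {..<n * 5 ^ m})"
  define \<delta> :: real where "\<delta> = (1 - 1 / 5 ^ (k - 1)) ^ m"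
  define G where "G = {j \<in> ?E. \<forall>l<r. good_draw m n r l b j}"
  define K where "K = (\<lambda>l. {j \<in> ?E. \<not> good_draw m n r l b j})"
  have fE: "finite ?E" by (intro finite_PiE) auto
  have K: "real (card (K l)) \<le> real (n * 5 ^ m) ^ r * \<delta>" if l: "l < r" for l
  proof -
    define S where "S = {i. i < r \<and> b i = l}"
    show ?thesis
    proof (cases "S = {}")
      case True
      \<comment> \<open>A copy without draws is vacuously good, since with \<open>m > 0\<close>
        there is a digit position to choose.\<close>
      then have "good_draw m n r l b j" for j
        unfolding good_draw_def using assms(1) by (auto simp: S_def)
      then have "K l = {}" by (auto simp: K_def)
      moreover have "\<delta> \<ge> 0" unfolding \<delta>_def by (intro zero_le_power) simp
      ultimately show ?thesis by simp
    next
      case False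
      have S: "S \<subseteq> {..<r}" "card S \<le> k" using assms(3)[OF l] by (auto simp: S_def)
      have "K l = {j \<in> ?E. \<forall>e<m. \<not> (\<exists>s. \<forall>i\<in>S. digit n e (j i) = s)}"
        unfolding K_def by (rule Collect_cong) (simp add: good_draw_def S_def)
      then have "real (card (K l)) \<le> real (n * 5 ^ m) ^ card {..<r} * (1 - 1 / 5 ^ (card S - 1)) ^ m"
        using card_no_common_digit_le[OF _ S(1) False, of n m] by simp
      also have "\<dots> \<le> real (n * 5 ^ m) ^ r * \<delta>"
        unfolding \<delta>_def card_lessThan
      proof (intro mult_left_mono power_mono)
        have "(5::real) ^ (card S - 1) \<le> 5 ^ (k - 1)" using S(2) by (intro power_increasing) auto
        then show "1 - 1 / 5 ^ (card S - 1) \<le> (1 - 1 / 5 ^ (k - 1) :: real)"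
          by (simp add: frac_le)
      qed auto
      finally show ?thesis .
    qed
  qed
  have "?E - G \<subseteq> (\<Union>l<r. K l)" by (auto simp: G_def K_def)
  moreover have "finite (\<Union>l<r. K l)" by (rule finite_subset[OF _ fE]) (auto simp: K_def)
  ultimately have "card (?E - G) \<le> card (\<Union>l<r. K l)" by (intro card_mono)
  also have "\<dots> \<le> (\<Sum>l<r. card (K l))" by (rule card_UN_le) simp
  finally have "real (card (?E - G)) \<le> (\<Sum>l<r. real (card (K l)))"
    by (metis of_nat_mono of_nat_sum)
  also have "\<dots> \<le> (\<Sum>l<r. real (n * 5 ^ m) ^ r * \<delta>)" by (intro sum_mono K) simp
  finally have "real (card (?E - G)) \<le> real (n * 5 ^ m) ^ r * (real r * \<delta>)" by (simp add: mult_ac)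
  moreover have "real (card (?E - G)) = real (card ?E) - real (card G)"
    by (rule real_card_Diff[OF fE]) (auto simp: G_def)
  moreover have "card ?E = (n * 5 ^ m) ^ r" by (simp add: card_PiE)
  ultimately show ?thesis
    unfolding G_def[symmetric] \<delta>_def[symmetric] by (simp add: right_diff_distrib)
qed

lemma good_draw_face:
  assumes "k > 0" "n > 0" "m > 0" "r > 0"
    and b: "b \<in> PiE {..<r} (\<lambda>_. {..<r})" "\<And>l. l < r \<Longrightarrow> card {i. i < r \<and> b i = l} \<le> k"
    and j: "j \<in> PiE {..<r} (\<lambda>_. {..<n * 5 ^ m})" "\<And>l. l < r \<Longrightarrow> good_draw m n r l b j"
  shows "is_face (6 * k * r * (m + 1)) (convex hull ((\<lambda>i. Qvert k m n (b i, j i)) ` {..<r})) (Qpoly k m n r)"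
proof -
  define G where "G = (\<lambda>i. (b i, j i)) ` {..<r}"
  have br: "b i < r" if "i < r" for i using PiE_mem[OF b(1), of i] that by simp
  have jN: "j i < n * 5 ^ m" if "i < r" for i using PiE_mem[OF j(1), of i] that by simp
  have "is_face (6 * k * r * (m + 1)) (convex hull (Qvert k m n ` G)) (Qpoly k m n r)"
  proof (rule Q_face[OF assms(1,2)])
    show "G \<subseteq> {..<r} \<times> {..<n * 5 ^ m}" using br jN by (auto simp: G_def)
    show "G \<noteq> {}" using assms(4) by (auto simp: G_def)
    fix l assume "l \<in> fst ` G"
    then have l: "l < r" using br by (auto simp: G_def)
    have eq: "{x. (l, x) \<in> G} = j ` {i. i < r \<and> b i = l}" by (auto simp: G_def)
    \<comment> \<open>Draws may repeat a vertex, so this is only an inequality.\<close>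
    have "card {x. (l, x) \<in> G} \<le> card {i. i < r \<and> b i = l}"
      unfolding eq by (rule card_image_le) simp
    then have "card {x. (l, x) \<in> G} \<le> k" using b(2)[OF l] by simp
    moreover obtain e s where es: "e < m" "\<And>i. i < r \<Longrightarrow> b i = l \<Longrightarrow> digit n e (j i) = s"
      using j(2)[OF l] unfolding good_draw_def by blast
    then have "\<forall>x. (l, x) \<in> G \<longrightarrow> digit n e x = s" by (auto simp: G_def)
    ultimately show "card {j. (l, j) \<in> G} \<le> k \<and> (\<exists>e<m. \<exists>s. \<forall>j. (l, j) \<in> G \<longrightarrow> digit n e j = s)"
      using es(1) by blast
  qed
  then show ?thesis by (simp add: G_def image_image)
qed

lemma card_Sigma_ge:
  assumes "finite A" "\<And>x. x \<in> A \<Longrightarrow> finite (B x)" "\<And>x. x \<in> A \<Longrightarrow> c \<le> real (card (B x))"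
  shows "real (card A) * c \<le> real (card (Sigma A B))"
proof -
  have "real (card A) * c = (\<Sum>x\<in>A. c)" by simp
  also have "\<dots> \<le> (\<Sum>x\<in>A. real (card (B x)))" by (rule sum_mono) (rule assms(3))
  also have "\<dots> = real (card (Sigma A B))" using assms(1,2) by (simp add: card_SigmaI)
  finally show ?thesis .
qed

text \<open>First the distribution over the copies is chosen, then the indices. The second bound
  holds uniformly for every \<open>b\<close> in \<open>L\<close>, so the two factors
  multiply.\<close>

lemma card_face_tuples_ge:
  assumes "k > 0" "m > 0" "n > 0" "r > 0"
  defines "\<delta> \<equiv> (1 - 1 / 5 ^ (k - 1)) ^ m :: real"
  assumes "real r * \<delta> \<le> 1"
  shows "real (card {f \<in> PiE {..<r} (\<lambda>_. vertices (Qpoly k m n r)).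
            is_face (6 * k * r * (m + 1)) (convex hull (f ` {..<r})) (Qpoly k m n r)})
     \<ge> real (r * (n * 5 ^ m)) ^ r * ((1 - real r / fact (k + 1)) * (1 - real r * \<delta>))"
proof -
  define N where "N = n * 5 ^ m"
  let ?V = "vertices (Qpoly k m n r)"
  define F where "F = {f \<in> PiE {..<r} (\<lambda>_. ?V).
    is_face (6 * k * r * (m + 1)) (convex hull (f ` {..<r})) (Qpoly k m n r)}"
  define L where "L = {b \<in> PiE {..<r} (\<lambda>_. {..<r}). \<forall>l<r. card {i. i < r \<and> b i = l} \<le> k}"
  define J where "J = (\<lambda>b. {j \<in> PiE {..<r} (\<lambda>_. {..<N}). \<forall>l<r. good_draw m n r l b j})"
  define \<Phi> where "\<Phi> = (\<lambda>(b, j). restrict (\<lambda>i. Qvert k m n (b i, j i)) {..<r})"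
  note inj = Q_vertices(1)[OF assms(1,3,2), of r, folded N_def]
  note V = Q_vertices(2)[OF assms(1,3,2), of r, folded N_def]
  have fin: "finite (PiE {..<r} (\<lambda>_. {..<a}))" for a :: nat by (intro finite_PiE) auto
  have fL: "finite L" unfolding L_def by (rule finite_subset[OF _ fin]) auto
  have fJ: "finite (J b)" for b unfolding J_def by (rule finite_subset[OF _ fin]) auto
  have "finite (PiE {..<r} (\<lambda>_. ?V))" unfolding V by (intro finite_PiE) auto
  then have fF: "finite F" unfolding F_def by (rule finite_subset[rotated]) auto
  have mem: "(b i, j i) \<in> {..<r} \<times> {..<N}" if "(b, j) \<in> Sigma L J" "i < r" for b j i
    using that by (auto simp: L_def J_def)
  have "inj_on \<Phi> (Sigma L J)"
  proof (rule inj_onI, clarify)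
    fix b j b' j'
    assume b: "b \<in> L" "b' \<in> L" and j: "j \<in> J b" "j' \<in> J b'" and eq: "\<Phi> (b, j) = \<Phi> (b', j')"
    have "(b i, j i) = (b' i, j' i)" if i: "i < r" for i
    proof (rule inj_onD[OF inj])
      show "Qvert k m n (b i, j i) = Qvert k m n (b' i, j' i)"
        using fun_cong[OF eq, of i] i by (simp add: \<Phi>_def)
    qed (use mem[of b j i] mem[of b' j' i] b j i in blast)+
    then have eqs: "b i = b' i" "j i = j' i" if "i \<in> {..<r}" for i using that by auto
    have mems: "b \<in> PiE {..<r} (\<lambda>_. {..<r})" "b' \<in> PiE {..<r} (\<lambda>_. {..<r})"
      "j \<in> PiE {..<r} (\<lambda>_. {..<N})" "j' \<in> PiE {..<r} (\<lambda>_. {..<N})"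
      using b j by (auto simp: L_def J_def)
    show "b = b' \<and> j = j'"
      using PiE_ext[OF mems(1,2) eqs(1)] PiE_ext[OF mems(3,4) eqs(2)] by blast
  qed
  moreover have "\<Phi> ` Sigma L J \<subseteq> F"
  proof clarify
    fix b j assume b: "b \<in> L" and j: "j \<in> J b"
    have "\<Phi> (b, j) ` {..<r} = (\<lambda>i. Qvert k m n (b i, j i)) ` {..<r}" by (auto simp: \<Phi>_def)
    moreover have "is_face (6 * k * r * (m + 1)) (convex hull ((\<lambda>i. Qvert k m n (b i, j i)) ` {..<r})) (Qpoly k m n r)"
      by (rule good_draw_face[OF assms(1,3,2,4)]) (use b j in \<open>auto simp: L_def J_def N_def\<close>)
    moreover have "\<Phi> (b, j) \<in> PiE {..<r} (\<lambda>_. ?V)"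
      unfolding V \<Phi>_def using mem b j by auto
    ultimately show "\<Phi> (b, j) \<in> F" unfolding F_def by simp
  qed
  ultimately have "card (Sigma L J) \<le> card F" by (rule card_inj_on_le[OF _ _ fF])
  define c where "c = real N ^ r * (1 - real r * \<delta>)"
  \<comment> \<open>The lower bound for \<open>card L\<close> is multiplied by \<open>c\<close>,
    which requires this sign.\<close>
  have "c \<ge> 0" unfolding c_def using assms(6) by simp
  have "real (r * N) ^ r * ((1 - real r / fact (k + 1)) * (1 - real r * \<delta>))
      = real r ^ r * (1 - real r / fact (k + 1)) * c"
    by (simp only: c_def of_nat_mult power_mult_distrib mult_ac)
  also have "\<dots> \<le> real (card L) * c"
    unfolding L_def by (rule mult_right_mono[OF card_small_fibres_ge \<open>c \<ge> 0\<close>])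
  also have "\<dots> \<le> real (card (Sigma L J))"
  proof (rule card_Sigma_ge[OF fL fJ])
    fix b assume "b \<in> L"
    then show "c \<le> real (card (J b))"
      using card_common_digits_ge[OF assms(2,1), of r b n] by (simp add: c_def J_def N_def \<delta>_def L_def)
  qed
  also have "\<dots> \<le> real (card F)" using \<open>card (Sigma L J) \<le> card F\<close> by simp
  finally show ?thesis unfolding F_def N_def .
qed

text \<open>For \<open>k = 1\<close> the quotient in the minimum has denominator 0 and stands for
  infinity, while division by 0 gives 0 in HOL; hence that bound is imposed only for
  \<open>k \<ge> 2\<close>.\<close>

theorem theorem1p5:
  fixes k m n r :: nat
  assumes "k > 0" "m > 0" "n > 0" "r > 0" "even n"
    and "real r < fact (k + 1)"
    and "k \<ge> 2 \<longrightarrow> real r < (5 ^ (k - 1) / (5 ^ (k - 1) - 1)) ^ m"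
  shows "face_prob (6 * k * r * (m + 1)) r (Qpoly k m n r)
           \<ge> (1 - real r / fact (k + 1)) * (1 - real r * (1 - 1 / 5 ^ (k - 1)) ^ m)"
proof -
  let ?V = "vertices (Qpoly k m n r)" and ?N = "r * (n * 5 ^ m)"
  have "real r * (1 - 1 / 5 ^ (k - 1)) ^ m \<le> 1"
  proof (cases "k \<ge> 2")
    case True
    define x :: real where "x = 5 ^ (k - 1)"
    have "x > 1" unfolding x_def using True by (intro one_less_power) auto
    then have "(x / (x - 1)) ^ m * (1 - 1 / x) ^ m = 1"
      by (simp add: power_mult_distrib[symmetric] field_simps)
    moreover have "real r * (1 - 1 / x) ^ m \<le> (x / (x - 1)) ^ m * (1 - 1 / x) ^ m"
      using assms(7) True \<open>x > 1\<close> unfolding x_def by (intro mult_right_mono) auto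
    ultimately show ?thesis unfolding x_def by simp
  next
    case False
    \<comment> \<open>Here \<open>k = 1\<close>, the base is \<open>1 - 1 = 0\<close>, and its power
      vanishes because \<open>m > 0\<close>.\<close>
    then show ?thesis using assms(1,2) by (simp add: power_0_left)
  qed
  note ge = card_face_tuples_ge[OF assms(1-4) this]
  have "card ?V = ?N"
    unfolding Q_vertices(2)[OF assms(1,3,2)] card_image[OF Q_vertices(1)[OF assms(1,3,2)]] by simp
  then have "real (card (PiE {..<r} (\<lambda>_. ?V))) = real ?N ^ r" by (simp add: card_PiE)
  moreover have "real ?N ^ r > 0" using assms(3,4) by simp
  ultimately show ?thesis
    unfolding face_prob_def using ge by (simp only: pos_le_divide_eq mult.commute)
qed

end
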